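(* Let $G$ be the disjoint union of two clique trees $W_1$ and $W_2$. Let $\hat{W}_2$ be the connected component of $T_{W_1}^{[\sharp 2]}$ which is not $W_1$. Then there exists a tree $T$ such that $T^{[\sharp 2]}=G$ if and only if there is an isomorphism $\varphi$ of $\hat{W}_2$ to a subgraph of $W_2$ satisfying: (1) for every vertex $v$ of $\hat{W}_2$, the degree $d_{T_{W_1}}(v)$ of $v$ in $T_{W_1}$ is at least the number of blocks of $W_2$ containing $\varphi(v)$; (2) every cut-vertex of $W_2$ belongs to the image $\varphi(\hat{W}_2)$.
   Context: All graphs are finite and simple. For a graph $H=(V,E)$, its exact-distance square $H^{[\sharp 2]}$ is the graph with vertex set $V$ in which distinct vertices $x,y$ are adjacent if and only if their distance in $H$ is exactly $2$. A block of a graph is a maximal subgraph without cut-vertices. A clique tree is a connected graph each of whose blocks is a complete graph. For a clique tree $W$, the canonical tree $T_W$ is the graph with vertex set $V(W)\cup\{v_B : B \text{ a block of } W\}$, where the $v_B$ are new vertices (one per block), and edge set $\{u v_B : B \text{ a block of } W,\ u\in V(B)\}$; it is a tree, and $W$ is one of the connected components of $T_W^{[\sharp 2]}$.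
   Formalization: "Subgraph of W_2" is taken as induced subgraph; with arbitrary subgraphs the "if" direction fails, e.g. W_1 a path on four vertices and W_2 a triangle, where a path on three vertices embeds with (1) and (2) but no tree T exists. *)

theory Defs
  imports Main "HOL-Library.Extended_Nat"
begin

datatype 'a ugraph = Graph (verts: "'a set") (edges: "'a set set")

definition simple_graph :: "'a ugraph \<Rightarrow> bool" where
  "simple_graph G \<longleftrightarrow> finite (verts G) \<and> (\<forall>e\<in>edges G. e \<subseteq> verts G \<and> card e = 2)"

definition adj :: "'a ugraph \<Rightarrow> 'a \<Rightarrow> 'a \<Rightarrow> bool" where
  "adj G x y \<longleftrightarrow> {x, y} \<in> edges G"

definition degree :: "'a ugraph \<Rightarrow> 'a \<Rightarrow> nat" where
  "degree G v = card {u. adj G v u}"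

definition subgraph :: "'a ugraph \<Rightarrow> 'a ugraph \<Rightarrow> bool" where
  "subgraph H G \<longleftrightarrow> simple_graph H \<and> verts H \<subseteq> verts G \<and> edges H \<subseteq> edges G"

definition induced_subgraph :: "'a ugraph \<Rightarrow> 'a ugraph \<Rightarrow> bool" where
  "induced_subgraph H G \<longleftrightarrow> subgraph H G \<and> (\<forall>e\<in>edges G. e \<subseteq> verts H \<longrightarrow> e \<in> edges H)"

definition delete_vertex :: "'a ugraph \<Rightarrow> 'a \<Rightarrow> 'a ugraph" where
  "delete_vertex G v = Graph (verts G - {v}) {e \<in> edges G. v \<notin> e}"

definition graph_union :: "'a ugraph \<Rightarrow> 'a ugraph \<Rightarrow> 'a ugraph" where
  "graph_union G H = Graph (verts G \<union> verts H) (edges G \<union> edges H)"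

definition graph_image :: "('a \<Rightarrow> 'b) \<Rightarrow> 'a ugraph \<Rightarrow> 'b ugraph" where
  "graph_image f G = Graph (f ` verts G) ((\<lambda>e. f ` e) ` edges G)"

definition graph_iso :: "('a \<Rightarrow> 'b) \<Rightarrow> 'a ugraph \<Rightarrow> 'b ugraph \<Rightarrow> bool" where
  "graph_iso f G H \<longleftrightarrow> bij_betw f (verts G) (verts H) \<and>
     (\<forall>x\<in>verts G. \<forall>y\<in>verts G. adj G x y \<longleftrightarrow> adj H (f x) (f y))"

text \<open>A walk is given by its list of vertices, so its length is one less than that of the list.\<close>

definition walk_betw :: "'a ugraph \<Rightarrow> 'a \<Rightarrow> 'a list \<Rightarrow> 'a \<Rightarrow> bool" where
  "walk_betw G x p y \<longleftrightarrow>
     p \<noteq> [] \<and> hd p = x \<and> last p = y \<and> set p \<subseteq> verts G \<and> successively (adj G) p"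

definition joined :: "'a ugraph \<Rightarrow> 'a \<Rightarrow> 'a \<Rightarrow> bool" where
  "joined G x y \<longleftrightarrow> (\<exists>p. walk_betw G x p y)"

text \<open>The distance is infinite when no walk joins the two vertices.\<close>

definition gdist :: "'a ugraph \<Rightarrow> 'a \<Rightarrow> 'a \<Rightarrow> enat" where
  "gdist G x y = (INF p\<in>{p. walk_betw G x p y}. enat (length p - 1))"

definition exact_dist_square :: "'a ugraph \<Rightarrow> 'a ugraph" where
  "exact_dist_square H =
     Graph (verts H) {{x, y} | x y. x \<in> verts H \<and> y \<in> verts H \<and> x \<noteq> y \<and> gdist H x y = 2}"

definition connected_graph :: "'a ugraph \<Rightarrow> bool" where
  "connected_graph G \<longleftrightarrow> verts G \<noteq> {} \<and> (\<forall>x\<in>verts G. \<forall>y\<in>verts G. joined G x y)"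

definition connected_component :: "'a ugraph \<Rightarrow> 'a ugraph \<Rightarrow> bool" where
  "connected_component G C \<longleftrightarrow> subgraph C G \<and> connected_graph C \<and>
     (\<forall>D. subgraph D G \<and> connected_graph D \<and> subgraph C D \<longrightarrow> D = C)"

definition cycle :: "'a ugraph \<Rightarrow> 'a list \<Rightarrow> bool" where
  "cycle G p \<longleftrightarrow> length p \<ge> 3 \<and> distinct p \<and> set p \<subseteq> verts G \<and>
     successively (adj G) p \<and> adj G (last p) (hd p)"

definition tree :: "'a ugraph \<Rightarrow> bool" where
  "tree T \<longleftrightarrow> simple_graph T \<and> connected_graph T \<and> (\<nexists>p. cycle T p)"

text \<open>A cut-vertex separates two other vertices of its component.\<close>

definition cut_vertex :: "'a ugraph \<Rightarrow> 'a \<Rightarrow> bool" where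
  "cut_vertex G v \<longleftrightarrow> v \<in> verts G \<and>
     (\<exists>x\<in>verts G - {v}. \<exists>y\<in>verts G - {v}. joined G x y \<and> \<not> joined (delete_vertex G v) x y)"

text \<open>As usual, blocks are required to be connected (and nonempty); the only block of a
  one-vertex graph is the graph itself.\<close>

definition nonseparable :: "'a ugraph \<Rightarrow> bool" where
  "nonseparable B \<longleftrightarrow> connected_graph B \<and> (\<nexists>v. cut_vertex B v)"

definition block :: "'a ugraph \<Rightarrow> 'a ugraph \<Rightarrow> bool" where
  "block G B \<longleftrightarrow> subgraph B G \<and> nonseparable B \<and>
     (\<forall>C. subgraph C G \<and> nonseparable C \<and> subgraph B C \<longrightarrow> C = B)"

definition complete_graph :: "'a ugraph \<Rightarrow> bool" where
  "complete_graph G \<longleftrightarrow> (\<forall>x\<in>verts G. \<forall>y\<in>verts G. x \<noteq> y \<longrightarrow> adj G x y)"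

definition clique_tree :: "'a ugraph \<Rightarrow> bool" where
  "clique_tree W \<longleftrightarrow> simple_graph W \<and> connected_graph W \<and> (\<forall>B. block W B \<longrightarrow> complete_graph B)"

text \<open>The vertex \<open>u\<close> of \<open>W\<close> becomes \<open>Inl u\<close>, and the new vertex of the block \<open>B\<close> is \<open>Inr B\<close>.\<close>

definition canonical_tree :: "'a ugraph \<Rightarrow> ('a + 'a ugraph) ugraph" where
  "canonical_tree W =
     Graph (Inl ` verts W \<union> Inr ` {B. block W B})
           {{Inl u, Inr B} | u B. block W B \<and> u \<in> verts B}"

text \<open>Let \<open>What\<close> be the second component of the exact-distance square of the canonical tree
  of \<open>W1\<close>. Embeddings \<open>\<phi>\<close> of \<open>What\<close> into \<open>W2\<close> are
  taken to be isomorphisms onto an induced subgraph: with arbitrary subgraphs, the degree and cut-vertex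
  conditions on \<open>\<phi>\<close> do not suffice for the existence of a tree whose exact-distance square
  is the union of \<open>W1\<close> and \<open>W2\<close>. For example, let \<open>W1\<close> be a path on
  four vertices and \<open>W2\<close> a triangle. Then \<open>What\<close> is a path on three vertices, each
  of degree 2 in the canonical tree, and it is isomorphic to a non-induced subgraph of \<open>W2\<close>,
  which has one block and no cut-vertex. But in a tree whose exact-distance square has the triangle as one of
  its two components, the vertices of the triangle have a common neighbour \<open>b\<close>. Every other
  vertex of the other component is a neighbour of one of them, hence at distance 2 from \<open>b\<close>,
  whereas no vertex of a path on four vertices is adjacent to all the others.\<close>

end

theory Submission
  imports Defs
begin

text \<open>In a tree \<open>T\<close> whose exact-distance square is the union of \<open>W1\<close> and \<open>W2\<close>, every edge joins
  a vertex of \<open>W1\<close> to one of \<open>W2\<close>, and, since \<open>T\<close> has no cycles of length 4 or 6, the blocks of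
  \<open>W1\<close> are neighbourhoods of vertices of \<open>W2\<close> and vice versa; sending a block to such a vertex
  embeds \<open>What\<close> into \<open>W2\<close>. Conversely, an embedding \<open>f\<close> of the blocks of \<open>W1\<close> is extended to a
  tree by attaching each block \<open>D\<close> of \<open>W2\<close> to its own vertex \<open>g D\<close> of \<open>W1\<close>, chosen
  in all the blocks \<open>B\<close> with \<open>f B\<close> in \<open>D\<close>: \<open>g D\<close> is then joined to the vertices
  of \<open>D\<close>, and the vertices outside the range of \<open>g\<close> become leaves.\<close>

section \<open>Walks, distance two and blocks\<close>

text \<open>The tree built in the converse direction is the union of the two canonical trees:
  \<open>f\<close> identifies the new vertex for a block \<open>B\<close> of \<open>W1\<close> with
  \<open>f B\<close> in \<open>W2\<close>, and \<open>g\<close> identifies the new vertex for a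
  block \<open>D\<close> of \<open>W2\<close> with \<open>g D\<close> in \<open>W1\<close>. The
  requirement that \<open>g D\<close> lie in \<open>B\<close> whenever \<open>f B\<close> lies in
  \<open>D\<close> makes the two trees fit together, so that the neighbourhoods of
  \<open>f B\<close> and \<open>g D\<close> are exactly \<open>B\<close> and \<open>D\<close>. Each
  condition on the embedding removes one obstruction. If it were not induced, some \<open>D\<close>
  could contain the images of two disjoint blocks, leaving no candidate for \<open>g D\<close>. Two
  blocks of \<open>W2\<close> must not get the same vertex, since their vertices would become
  adjacent in the square; so \<open>B\<close> needs at least as many vertices as there are blocks
  through \<open>f B\<close>. A vertex outside the image and in two blocks of \<open>W2\<close>
  would give two vertices of \<open>W1\<close> a common neighbour that stands for no block of
  \<open>W1\<close>; hence the condition on cut-vertices.\<close>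

lemma adj_sym: "adj G x y \<Longrightarrow> adj G y x"
  by (simp add: adj_def insert_commute)

lemma simple_graph_adjD:
  assumes "simple_graph G" "adj G x y"
  shows "x \<in> verts G" "y \<in> verts G" "x \<noteq> y"
proof -
  have "{x, y} \<subseteq> verts G" "card {x, y} = 2"
    using assms by (auto simp: simple_graph_def adj_def)
  then show "x \<in> verts G" "y \<in> verts G" "x \<noteq> y" by auto
qed

lemma simple_graph_edgeE:
  assumes "simple_graph G" "e \<in> edges G"
  obtains x y where "e = {x, y}" "adj G x y"
proof -
  have "card e = 2" using assms by (auto simp: simple_graph_def)
  then obtain x y where "e = {x, y}" by (auto simp: card_2_iff)
  with assms that show thesis by (auto simp: adj_def)
qed

lemma edges_eq_adj: "simple_graph G \<Longrightarrow> edges G = {{x, y} | x y. adj G x y}"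
  by (auto simp: adj_def) (metis adj_def simple_graph_edgeE)

lemma simple_graph_eqI:
  assumes "simple_graph G" "simple_graph H" "verts G = verts H" "\<And>x y. adj G x y = adj H x y"
  shows "G = H"
  using assms by (simp add: ugraph.expand edges_eq_adj)

lemma subgraph_adj: "subgraph H G \<Longrightarrow> adj H x y \<Longrightarrow> adj G x y"
  by (auto simp: subgraph_def adj_def)

lemma subgraph_iff_adj:
  assumes "simple_graph H"
  shows "subgraph H G \<longleftrightarrow> verts H \<subseteq> verts G \<and> (\<forall>x y. adj H x y \<longrightarrow> adj G x y)"
proof -
  have "edges H \<subseteq> edges G" if "\<forall>x y. adj H x y \<longrightarrow> adj G x y"
    using that assms by (metis adj_def simple_graph_edgeE subsetI)
  then show ?thesis using assms by (auto simp: subgraph_def adj_def)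
qed

lemma simple_graphI:
  assumes "finite (verts G)" "\<And>x y. {x, y} \<in> edges G \<Longrightarrow> x \<in> verts G \<and> y \<in> verts G \<and> x \<noteq> y"
    and "\<And>e. e \<in> edges G \<Longrightarrow> \<exists>x y. e = {x, y}"
  shows "simple_graph G"
  unfolding simple_graph_def
proof (intro conjI ballI)
  fix e assume e: "e \<in> edges G"
  then obtain x y where xy: "e = {x, y}" using assms(3) by blast
  with e have "x \<in> verts G" "y \<in> verts G" "x \<noteq> y" using assms(2)[of x y] by auto
  with xy show "e \<subseteq> verts G" "card e = 2" by auto
qed (use assms in auto)

lemma rtranclp_adj_sym: "(adj G)\<^sup>*\<^sup>* x y \<Longrightarrow> (adj G)\<^sup>*\<^sup>* y x"
  by (induction rule: rtranclp_induct) (auto intro: adj_sym converse_rtranclp_into_rtranclp)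

section \<open>Reachability, paths and distance two\<close>

lemma successively_rtranclp:
  "successively R p \<Longrightarrow> p \<noteq> [] \<Longrightarrow> R\<^sup>*\<^sup>* (hd p) (last p)"
proof (induction p)
  case (Cons a p)
  show ?case
  proof (cases p)
    case (Cons b q)
    with Cons.prems Cons.IH have "R a b" "R\<^sup>*\<^sup>* b (last p)" by auto
    with Cons show ?thesis by (simp add: converse_rtranclp_into_rtranclp)
  qed simp
qed simp

text \<open>The relation is arbitrary because paths are needed in a graph with a vertex deleted and
  along edges not contained in a given block; both are later closed up to cycles of the whole
  graph.\<close>

lemma rtranclp_distinct_path:
  assumes "R\<^sup>*\<^sup>* x y"
  shows "\<exists>p. p \<noteq> [] \<and> hd p = x \<and> last p = y \<and> distinct p \<and> successively R p"
  using assms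
proof (induction rule: rtranclp_induct)
  case base
  show ?case by (rule exI[of _ "[x]"]) simp
next
  case (step y z)
  then obtain p where p: "p \<noteq> []" "hd p = x" "last p = y" "distinct p" "successively R p"
    by blast
  show ?case
  proof (cases "z \<in> set p")
    case True
    then obtain q r where qr: "p = q @ z # r" by (meson split_list)
    have "hd (q @ [z]) = x" using p(2) qr by (cases q) simp_all
    moreover have "distinct (q @ [z])" using p(4) qr by simp
    moreover have "successively R (q @ [z])" using p(5) qr by (simp add: successively_append_iff)
    ultimately show ?thesis by (intro exI[of _ "q @ [z]"]) simp
  next
    case False
    have "successively R (p @ [z])" using p step.hyps by (simp add: successively_append_iff)
    then show ?thesis using p False by (intro exI[of _ "p @ [z]"]) simp
  qed
qed

text \<open>Replaces walks by a closure that admits induction. Membership of \<open>x\<close> has to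
  be stated because the closure relates every element to itself.\<close>

lemma joined_iff:
  assumes "simple_graph G"
  shows "joined G x y \<longleftrightarrow> x \<in> verts G \<and> (adj G)\<^sup>*\<^sup>* x y"
proof
  assume "joined G x y"
  then obtain p where p: "p \<noteq> []" "hd p = x" "last p = y" "set p \<subseteq> verts G"
    "successively (adj G) p"
    unfolding joined_def walk_betw_def by blast
  have "x \<in> verts G" using p hd_in_set by blast
  with p successively_rtranclp[OF p(5,1)] show "x \<in> verts G \<and> (adj G)\<^sup>*\<^sup>* x y" by simp
next
  assume *: "x \<in> verts G \<and> (adj G)\<^sup>*\<^sup>* x y"
  then have "(adj G)\<^sup>*\<^sup>* x y" by simp
  then show "joined G x y"
    using conjunct1[OF *]
  proof (induction rule: rtranclp_induct)
    case base
    then have "walk_betw G x [x] x" by (simp add: walk_betw_def)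
    then show ?case unfolding joined_def by blast
  next
    case (step y z)
    then obtain p where "walk_betw G x p y" unfolding joined_def by blast
    then have "walk_betw G x (p @ [z]) z"
      using step.hyps(2) simple_graph_adjD[OF assms step.hyps(2)]
      by (simp add: walk_betw_def successively_append_iff)
    then show ?case unfolding joined_def by blast
  qed
qed

lemma gdist_eq_2_iff:
  assumes G: "simple_graph G" and xy: "x \<noteq> y"
  shows "gdist G x y = 2 \<longleftrightarrow> \<not> adj G x y \<and> (\<exists>z. adj G x z \<and> adj G z y)"
proof -
  let ?P = "{p. walk_betw G x p y}"
  let ?L = "(\<lambda>p. enat (length p - 1)) ` ?P"
  have le: "gdist G x y \<le> enat (length p - 1)" if "walk_betw G x p y" for p
    unfolding gdist_def by (rule INF_lower) (use that in simp)
  have two: "(2 :: enat) = enat 2" by (simp add: numeral_eq_enat)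
  show ?thesis
  proof
    assume d: "gdist G x y = 2"
    have "\<not> adj G x y"
    proof
      assume a: "adj G x y"
      have "walk_betw G x [x, y] y"
        using a simple_graph_adjD[OF G a] by (auto simp: walk_betw_def)
      from le[OF this] d show False by (simp add: two)
    qed
    have "?L \<noteq> {}"
    proof
      assume "?L = {}"
      then have "gdist G x y = \<infinity>" by (simp add: gdist_def Inf_enat_def)
      with d show False by (simp add: two)
    qed
    \<comment> \<open>The infimum of a nonempty set in \<open>enat\<close> is attained, so there is
      a shortest walk; distance 2 makes its list three entries long.\<close>
    then have "Inf ?L \<in> ?L" unfolding Inf_enat_def by (simp only: if_False) (metis LeastI ex_in_conv)
    then obtain p where p: "walk_betw G x p y" "gdist G x y = enat (length p - 1)"
      unfolding gdist_def by auto
    with d have "length p = Suc (Suc (Suc 0))" by (simp add: two)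
    then obtain a b c where "p = [a, b, c]" by (auto simp: length_Suc_conv)
    with p(1) \<open>\<not> adj G x y\<close> show "\<not> adj G x y \<and> (\<exists>z. adj G x z \<and> adj G z y)"
      by (auto simp: walk_betw_def)
  next
    assume *: "\<not> adj G x y \<and> (\<exists>z. adj G x z \<and> adj G z y)"
    then obtain z where z: "adj G x z" "adj G z y" by blast
    have "walk_betw G x [x, z, y] y"
      using z simple_graph_adjD[OF G z(1)] simple_graph_adjD[OF G z(2)] by (auto simp: walk_betw_def)
    from le[OF this] have "gdist G x y \<le> 2" by (simp add: two eval_nat_numeral)
    moreover have "2 \<le> gdist G x y"
      unfolding gdist_def
    proof (rule INF_greatest)
      fix p assume "p \<in> ?P"
      then have p: "p \<noteq> []" "hd p = x" "last p = y" "successively (adj G) p"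
        by (auto simp: walk_betw_def)
      have "length p - 1 \<ge> 2"
      proof (rule ccontr)
        assume "\<not> ?thesis"
        with p(1) consider a where "p = [a]" | a b where "p = [a, b]"
          by (cases p; cases "tl p"; cases "tl (tl p)") auto
        then show False using p xy * by cases auto
      qed
      then show "(2 :: enat) \<le> enat (length p - 1)" by (simp add: two)
    qed
    ultimately show "gdist G x y = 2" by (rule antisym)
  qed
qed

lemma verts_exact_dist_square [simp]: "verts (exact_dist_square G) = verts G"
  by (simp add: exact_dist_square_def)

lemma simple_exact_dist_square: "simple_graph G \<Longrightarrow> simple_graph (exact_dist_square G)"
  by (auto simp: exact_dist_square_def simple_graph_def)

lemma adj_exact_dist_square:
  assumes "simple_graph G"
  shows "adj (exact_dist_square G) x y \<longleftrightarrow> x \<noteq> y \<and> \<not> adj G x y \<and> (\<exists>z. adj G x z \<and> adj G z y)"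
proof -
  have "gdist G x y = 2 \<longleftrightarrow> gdist G y x = 2" if "x \<noteq> y"
    using that gdist_eq_2_iff[OF assms] by (metis adj_sym)
  then have "adj (exact_dist_square G) x y \<longleftrightarrow>
    x \<in> verts G \<and> y \<in> verts G \<and> x \<noteq> y \<and> gdist G x y = 2"
    by (auto simp: adj_def exact_dist_square_def doubleton_eq_iff)
  then show ?thesis
    using gdist_eq_2_iff[OF assms] simple_graph_adjD[OF assms] by metis
qed

section \<open>Cliques, cycles and nonseparable subgraphs\<close>

definition clique :: "'a ugraph \<Rightarrow> 'a set \<Rightarrow> bool" where
  "clique G S \<longleftrightarrow> S \<subseteq> verts G \<and> (\<forall>x\<in>S. \<forall>y\<in>S. x \<noteq> y \<longrightarrow> adj G x y)"

definition induced_on :: "'a ugraph \<Rightarrow> 'a set \<Rightarrow> 'a ugraph" where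
  "induced_on G S = Graph S {e \<in> edges G. e \<subseteq> S}"

lemma verts_induced_on [simp]: "verts (induced_on G S) = S"
  by (simp add: induced_on_def)

lemma adj_induced_on [simp]: "adj (induced_on G S) x y \<longleftrightarrow> adj G x y \<and> x \<in> S \<and> y \<in> S"
  by (auto simp: induced_on_def adj_def)

lemma simple_induced_on: "simple_graph G \<Longrightarrow> S \<subseteq> verts G \<Longrightarrow> simple_graph (induced_on G S)"
  by (auto simp: simple_graph_def induced_on_def intro: finite_subset)

lemma subgraph_induced_on: "simple_graph G \<Longrightarrow> S \<subseteq> verts G \<Longrightarrow> subgraph (induced_on G S) G"
  by (simp add: subgraph_iff_adj simple_induced_on)

lemma simple_delete_vertex: "simple_graph G \<Longrightarrow> simple_graph (delete_vertex G v)"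
  by (auto simp: simple_graph_def delete_vertex_def)

lemma verts_delete_vertex [simp]: "verts (delete_vertex G v) = verts G - {v}"
  by (simp add: delete_vertex_def)

lemma adj_delete_vertex [simp]: "adj (delete_vertex G v) x y \<longleftrightarrow> adj G x y \<and> x \<noteq> v \<and> y \<noteq> v"
  by (auto simp: delete_vertex_def adj_def)

lemma connected_graphI:
  assumes "simple_graph G" "v \<in> verts G" "\<And>x. x \<in> verts G \<Longrightarrow> (adj G)\<^sup>*\<^sup>* v x"
  shows "connected_graph G"
  unfolding connected_graph_def using assms
  by (auto simp: joined_iff) (meson rtranclp_adj_sym rtranclp_trans)

lemma connected_graphD:
  assumes "simple_graph G" "connected_graph G" "x \<in> verts G" "y \<in> verts G"
  shows "(adj G)\<^sup>*\<^sup>* x y"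
  using assms by (auto simp: connected_graph_def joined_iff)

text \<open>If the neighbours of \<open>v\<close> were pairwise adjacent, every walk through \<open>v\<close> could bypass it.\<close>

lemma cut_vertex_nonadjacent_neighbours:
  assumes G: "simple_graph G" and v: "cut_vertex G v"
  obtains a b where "adj G v a" "adj G v b" "a \<noteq> b" "\<not> adj G a b"
proof -
  obtain x y where xy: "x \<in> verts G - {v}" "y \<in> verts G - {v}" "(adj G)\<^sup>*\<^sup>* x y"
    "\<not> (adj (delete_vertex G v))\<^sup>*\<^sup>* x y"
    using v by (auto simp: cut_vertex_def joined_iff G simple_delete_vertex)
  have False if nb: "\<And>a b. adj G v a \<Longrightarrow> adj G v b \<Longrightarrow> a \<noteq> b \<Longrightarrow> adj G a b"
  proof -
    let ?R = "(adj (delete_vertex G v))\<^sup>*\<^sup>*"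
    have "(z \<noteq> v \<longrightarrow> ?R x z) \<and> (z = v \<longrightarrow> (\<exists>z'. adj G v z' \<and> ?R x z'))" if "(adj G)\<^sup>*\<^sup>* x z" for z
      using that
    proof (induction rule: rtranclp_induct)
      case base
      then show ?case using xy by auto
    next
      case (step z z')
      have nz: "z \<noteq> z'" using simple_graph_adjD[OF G step.hyps(2)] by simp
      show ?case
      proof (cases "z = v")
        case True
        with step.IH obtain a where a: "adj G v a" "?R x a" by blast
        have "a \<noteq> v" using simple_graph_adjD[OF G a(1)] by simp
        then have "?R a z'"
          using nb[of a z'] a step.hyps True nz by (cases "a = z'") auto
        then have "?R x z'" using a by (meson rtranclp_trans)
        then show ?thesis using nz True by blast
      next
        case False
        then have z: "?R x z" using step.IH by blast
        show ?thesis
        proof (cases "z' = v")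
          case True
          then show ?thesis using z adj_sym[OF step.hyps(2)] by blast
        next
          case z': False
          then have "adj (delete_vertex G v) z z'" using False step.hyps by auto
          then show ?thesis using z z' by (meson rtranclp.rtrancl_into_rtrancl)
        qed
      qed
    qed
    from this[OF xy(3)] xy show False by auto
  qed
  then show thesis using that by blast
qed

text \<open>A cut-vertex would have two nonadjacent neighbours.\<close>

lemma nonseparable_clique:
  assumes G: "simple_graph G" and S: "clique G S" "S \<noteq> {}"
  shows "nonseparable (induced_on G S)"
proof -
  have SG: "S \<subseteq> verts G" and adj: "\<And>x y. x \<in> S \<Longrightarrow> y \<in> S \<Longrightarrow> x \<noteq> y \<Longrightarrow> adj G x y"
    using S by (auto simp: clique_def)
  note si = simple_induced_on[OF G SG]
  obtain v where "v \<in> S" using S by blast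
  have "connected_graph (induced_on G S)"
  proof (rule connected_graphI[OF si])
    show "v \<in> verts (induced_on G S)" using \<open>v \<in> S\<close> by simp
    show "(adj (induced_on G S))\<^sup>*\<^sup>* v x" if "x \<in> verts (induced_on G S)" for x
      using adj[of v x] that \<open>v \<in> S\<close> by (cases "x = v") auto
  qed
  moreover have "\<not> cut_vertex (induced_on G S) u" for u
    using cut_vertex_nonadjacent_neighbours[OF si] by (metis adj adj_induced_on)
  ultimately show ?thesis by (auto simp: nonseparable_def)
qed

text \<open>Deleting a vertex from a cycle leaves a path through all the others, so no two of them
  are separated.\<close>

lemma nonseparable_cycle:
  assumes G: "simple_graph G" and p: "cycle G p"
  shows "nonseparable (induced_on G (set p))"
proof -
  let ?H = "induced_on G (set p)"
  have pG: "set p \<subseteq> verts G" and len: "length p \<ge> 3" and dp: "distinct p"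
    using p by (auto simp: cycle_def)
  note si = simple_induced_on[OF G pG]
  \<comment> \<open>Cutting the cycle \<open>a @ v # b\<close> open at \<open>v\<close> gives the
    path \<open>b @ a\<close>, whose parts are joined by the closing edge.\<close>
  have rot: "\<exists>q. set q = set p - {v} \<and> v \<notin> set q \<and> q \<noteq> [] \<and> successively (adj G) q
     \<and> adj G v (hd q)" if "v \<in> set p" for v
  proof -
    from split_list[OF that] obtain a b where ab: "p = a @ v # b" by blast
    have s: "successively (adj G) (a @ v # b)" and c: "adj G (last (a @ v # b)) (hd (a @ v # b))"
      using p ab by (auto simp: cycle_def)
    show ?thesis
    proof (cases b)
      case Nil
      then have "a \<noteq> []" using len ab by (cases a) auto
      then show ?thesis using s c ab dp Nil
        by (intro exI[of _ a]) (auto simp: successively_append_iff)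
    next
      case (Cons b0 bs)
      then have b: "b \<noteq> []" by simp
      then have "successively (adj G) a" "successively (adj G) b" "adj G v (hd b)"
        using s by (auto simp: successively_append_iff successively_Cons)
      moreover have "adj G (last b) (hd a)" if "a \<noteq> []" using c b that by simp
      ultimately have "successively (adj G) (b @ a)" by (auto simp: successively_append_iff)
      then show ?thesis using \<open>adj G v (hd b)\<close> b ab dp
        by (intro exI[of _ "b @ a"]) auto
    qed
  qed
  have path: "R\<^sup>*\<^sup>* (hd q) x" if "successively R q" "x \<in> set q" for R :: "'a \<Rightarrow> 'a \<Rightarrow> bool" and x q
  proof -
    from split_list[OF that(2)] obtain a b where ab: "q = a @ x # b" by blast
    then have "successively R (a @ [x])" using that by (auto simp: successively_append_iff)
    from successively_rtranclp[OF this] show ?thesis using ab by (cases a) auto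
  qed
  have del: "(adj (delete_vertex ?H v))\<^sup>*\<^sup>* x y"
    if v: "v \<in> set p" and xy: "x \<in> set p - {v}" "y \<in> set p - {v}" for v x y
  proof -
    obtain q where q: "set q = set p - {v}" "successively (adj G) q" using rot[OF v] by blast
    then have "successively (adj (delete_vertex ?H v)) q"
      by (auto elim!: successively_mono)
    from path[OF this] q xy have "(adj (delete_vertex ?H v))\<^sup>*\<^sup>* (hd q) x"
      "(adj (delete_vertex ?H v))\<^sup>*\<^sup>* (hd q) y" by auto
    then show ?thesis by (meson rtranclp_adj_sym rtranclp_trans)
  qed
  have "p \<noteq> []" using len by auto
  have "successively (adj ?H) p"
    using p by (auto simp: cycle_def elim!: successively_mono)
  from path[OF this] have "connected_graph ?H"
    by (intro connected_graphI[OF si, of "hd p"]) (use \<open>p \<noteq> []\<close> in auto)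
  moreover have "\<not> cut_vertex ?H v" for v
    using del[of v] by (auto simp: cut_vertex_def joined_iff si simple_delete_vertex)
  ultimately show ?thesis by (auto simp: nonseparable_def)
qed

lemma nonseparable_in_block:
  assumes G: "simple_graph G" and H: "subgraph H G" "nonseparable H"
  obtains B where "block G B" "subgraph H B"
proof -
  \<comment> \<open>Counting edges as well as vertices makes every proper extension larger, even one
    that only adds edges; a subgraph with the largest count is then maximal.\<close>
  let ?M = "\<lambda>C. card (verts C) + card (edges C)"
  have finV: "finite (verts G)" using G by (simp add: simple_graph_def)
  have "edges G \<subseteq> Pow (verts G)" using G by (auto simp: simple_graph_def)
  then have finE: "finite (edges G)" using finV by (meson finite_Pow_iff finite_subset)
  let ?P = "\<lambda>C. subgraph C G \<and> nonseparable C \<and> subgraph H C"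
  have PH: "?P H" using H by (auto simp: subgraph_def)
  have "?M C \<le> ?M G" if "subgraph C G" for C
    using that finV finE by (auto simp: subgraph_def intro!: add_mono card_mono)
  then have "?M C < Suc (?M G)" if "?P C" for C
    using that by (simp add: less_Suc_eq_le)
  with PH obtain B where B: "?P B" and max: "\<And>C. ?P C \<Longrightarrow> ?M C \<le> ?M B"
    using ex_has_greatest_nat[of ?P H ?M "Suc (?M G)"] by blast
  have "C = B" if C: "subgraph C G" "nonseparable C" "subgraph B C" for C
  proof -
    have "subgraph H C" using B C by (auto simp: subgraph_def)
    with C max have le: "?M C \<le> ?M B" by blast
    have fin: "finite (verts C)" "finite (edges C)"
      using C finV finE by (auto simp: subgraph_def intro: finite_subset)
    have sub: "verts B \<subseteq> verts C" "edges B \<subseteq> edges C" using C by (auto simp: subgraph_def)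
    then have "card (verts B) \<le> card (verts C)" "card (edges B) \<le> card (edges C)"
      using fin by (auto intro: card_mono)
    with le have "verts B = verts C" "edges B = edges C"
      using card_subset_eq[OF fin(1) sub(1)] card_subset_eq[OF fin(2) sub(2)] by auto
    then show "C = B" by (simp add: ugraph.expand)
  qed
  with B show thesis by (intro that[of B]) (auto simp: block_def)
qed

section \<open>Clique trees\<close>

lemma clique_tree_simple: "clique_tree W \<Longrightarrow> simple_graph W"
  and clique_tree_connected: "clique_tree W \<Longrightarrow> connected_graph W"
  by (auto simp: clique_tree_def)

lemma clique_mono: "clique G S \<Longrightarrow> T \<subseteq> S \<Longrightarrow> clique G T"
  by (auto simp: clique_def)

lemma clique_edge: "simple_graph G \<Longrightarrow> adj G x y \<Longrightarrow> clique G {x, y}"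
  by (auto simp: clique_def adj_sym dest: simple_graph_adjD)

lemma block_verts_nonempty: "block G B \<Longrightarrow> verts B \<noteq> {}"
  by (auto simp: block_def nonseparable_def connected_graph_def)

lemma block_verts_subset: "block G B \<Longrightarrow> verts B \<subseteq> verts G"
  by (auto simp: block_def subgraph_def)

lemma successively_adj_verts:
  assumes "simple_graph G" "successively (adj G) p" "p \<noteq> []" "last p \<in> verts G"
  shows "set p \<subseteq> verts G"
  using assms(2-4)
proof (induction p)
  case (Cons a p)
  then show ?case using simple_graph_adjD(1)[OF assms(1)] by (cases "p = []") (auto simp: successively_Cons)
qed simp

context
  fixes W :: "'a ugraph"
  assumes W: "clique_tree W"
begin

lemma clique_tree_block_clique:
  assumes "block W B"
  shows "clique W (verts B)"
proof -
  have "subgraph B W" "complete_graph B" using W assms by (auto simp: block_def clique_tree_def)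
  then show ?thesis
    by (auto simp: clique_def complete_graph_def intro: subgraph_adj) (auto simp: subgraph_def)
qed

lemma clique_tree_blockD:
  assumes "block W B" "x \<in> verts B" "y \<in> verts B" "x \<noteq> y"
  shows "adj W x y"
  using clique_tree_block_clique[OF assms(1)] assms by (auto simp: clique_def)

lemma clique_tree_clique_in_block:
  assumes "clique W S" "S \<noteq> {}"
  obtains B where "block W B" "S \<subseteq> verts B"
proof -
  note G = clique_tree_simple[OF W]
  have "subgraph (induced_on W S) W" using assms by (auto simp: clique_def intro: subgraph_induced_on G)
  from nonseparable_in_block[OF G this nonseparable_clique[OF G assms]]
  show thesis using that by (auto simp: subgraph_def)
qed

text \<open>The induced subgraph on a clique is nonseparable, so the maximality of the block applies
  to it. Blocks can therefore be compared through their vertex sets.\<close>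

lemma clique_tree_block_eq_induced_on:
  assumes "block W B" "clique W S" "verts B \<subseteq> S"
  shows "B = induced_on W S"
proof -
  note G = clique_tree_simple[OF W]
  have B: "subgraph B W" using assms by (auto simp: block_def)
  have "S \<noteq> {}" using assms block_verts_nonempty by blast
  have S: "subgraph (induced_on W S) W" using assms by (auto simp: clique_def intro: subgraph_induced_on G)
  moreover have "subgraph B (induced_on W S)"
  proof -
    have "simple_graph B" using B by (auto simp: subgraph_def)
    then show ?thesis
      using B assms by (auto simp: subgraph_iff_adj dest: simple_graph_adjD)
  qed
  ultimately show ?thesis
    using nonseparable_clique[OF G assms(2) \<open>S \<noteq> {}\<close>] assms(1) by (auto simp: block_def)
qed

lemma clique_tree_block_maximal:
  "block W B \<Longrightarrow> clique W S \<Longrightarrow> verts B \<subseteq> S \<Longrightarrow> verts B = S"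
  using clique_tree_block_eq_induced_on[of B S] by simp

lemma clique_tree_block_eqI:
  "block W B \<Longrightarrow> block W D \<Longrightarrow> verts B \<subseteq> verts D \<Longrightarrow> B = D"
  using clique_tree_block_eq_induced_on clique_tree_block_clique by (metis order_refl)

text \<open>A cycle is nonseparable, so it lies in a block, which is complete. The tree-like
  behaviour of the blocks is derived from this fact.\<close>

lemma clique_tree_cycle_clique:
  assumes "cycle W p"
  shows "clique W (set p)"
proof -
  note G = clique_tree_simple[OF W]
  have "subgraph (induced_on W (set p)) W"
    using assms by (auto simp: cycle_def intro: subgraph_induced_on G)
  from nonseparable_in_block[OF G this nonseparable_cycle[OF G assms]]
  obtain B where "block W B" "subgraph (induced_on W (set p)) B" by blast
  then show ?thesis
    using clique_tree_block_clique clique_mono by (fastforce simp: subgraph_def)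
qed

text \<open>If \<open>a\<close> lies only in \<open>B\<close> and \<open>b\<close> only in
  \<open>D\<close>, then \<open>a\<close>, \<open>x\<close>, \<open>b\<close>, \<open>y\<close> form
  a 4-cycle, hence a clique. So the union of the two blocks is a clique, and maximality makes them
  equal.\<close>

lemma clique_tree_blocks_share:
  assumes B: "block W B" and D: "block W D"
    and xy: "x \<noteq> y" "{x, y} \<subseteq> verts B" "{x, y} \<subseteq> verts D"
  shows "B = D"
proof -
  note adjB = clique_tree_blockD[OF B] and adjD = clique_tree_blockD[OF D]
  have cross: "adj W a b" if "a \<in> verts B - verts D" "b \<in> verts D - verts B" for a b
  proof -
    have "adj W a x" "adj W y a" by (rule adjB; use that xy in auto)+
    moreover have "adj W x b" "adj W b y" by (rule adjD; use that xy in auto)+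
    ultimately have "cycle W [a, x, b, y]"
      using that xy block_verts_subset[OF B] block_verts_subset[OF D] by (auto simp: cycle_def)
    from clique_tree_cycle_clique[OF this] that show ?thesis by (auto simp: clique_def)
  qed
  have "adj W a b" if "a \<in> verts B \<union> verts D" "b \<in> verts B \<union> verts D" "a \<noteq> b" for a b
    using that adjB adjD cross adj_sym by (metis DiffI UnE)
  then have "clique W (verts B \<union> verts D)"
    using block_verts_subset[OF B] block_verts_subset[OF D] by (auto simp: clique_def)
  from clique_tree_block_maximal[OF B this] have "verts D \<subseteq> verts B" by auto
  then show ?thesis using clique_tree_block_eqI[OF D B] by simp
qed

lemma clique_tree_vertex_in_block:
  assumes "x \<in> verts W"
  obtains B where "block W B" "x \<in> verts B"
  using clique_tree_clique_in_block[of "{x}"] assms by (auto simp: clique_def)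

lemma clique_tree_adj_iff:
  "adj W x y \<longleftrightarrow> x \<noteq> y \<and> (\<exists>B. block W B \<and> x \<in> verts B \<and> y \<in> verts B)"
  using clique_tree_clique_in_block[of "{x, y}"] clique_edge[OF clique_tree_simple[OF W]]
    simple_graph_adjD(3)[OF clique_tree_simple[OF W]] clique_tree_blockD
  by (metis insert_not_empty insert_subset)

text \<open>A path joining two vertices of the block \<open>C\<close> closes up to a cycle, which lies in \<open>C\<close>.\<close>

lemma clique_tree_path_uses_block:
  assumes C: "block W C" and xy: "x \<in> verts C" "y \<in> verts C" "x \<noteq> y"
    and R: "\<And>a b. R a b \<Longrightarrow> adj W a b \<and> \<not> {a, b} \<subseteq> verts C"
  shows "\<not> R\<^sup>*\<^sup>* x y"
proof
  assume "R\<^sup>*\<^sup>* x y"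
  from rtranclp_distinct_path[OF this] obtain p where
    p: "p \<noteq> []" "hd p = x" "last p = y" "distinct p" "successively R p" by blast
  from p(1,2,3) xy obtain z q where pq: "p = x # z # q"
    by (cases p; cases "tl p") auto
  have Rxz: "R x z" using p pq by simp
  show False
  proof (cases q)
    \<comment> \<open>Two vertices make no cycle; here the only edge is \<open>{x, y}\<close>, which
      lies inside \<open>C\<close>.\<close>
    case Nil
    then show False using p pq R[OF Rxz] xy by auto
  next
    case (Cons c q')
    have s: "successively (adj W) p" using p(5) R by (auto elim: successively_mono)
    have v: "set p \<subseteq> verts W"
      using successively_adj_verts[OF clique_tree_simple[OF W] s] p xy block_verts_subset[OF C] by auto
    have "cycle W p"
      using p s v pq Cons clique_tree_blockD[OF C xy(2,1)] xy by (auto simp: cycle_def)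
    then obtain B where B: "block W B" "set p \<subseteq> verts B"
      using clique_tree_clique_in_block[OF clique_tree_cycle_clique] p(1) by (metis set_empty)
    then have "{x, y} \<subseteq> verts B" using p by (metis hd_in_set last_in_set insert_subset empty_subsetI subsetD)
    then have "B = C" using clique_tree_blocks_share[OF B(1) C xy(3)] xy by simp
    have "{x, z} \<subseteq> verts C" using B(2) pq unfolding \<open>B = C\<close> by simp
    with R[OF Rxz] show False by simp
  qed
qed

text \<open>A path avoiding \<open>x\<close> from another vertex of \<open>B\<close> to another
  vertex of \<open>D\<close> would close up through \<open>x\<close> to a cycle; a block containing
  that cycle shares two vertices with each of \<open>B\<close> and \<open>D\<close> and so equals
  both.\<close>

lemma clique_tree_two_blocks_cut_vertex:
  assumes B: "block W B" and D: "block W D" and ne: "B \<noteq> D" and x: "x \<in> verts B" "x \<in> verts D"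
  shows "cut_vertex W x"
proof -
  note G = clique_tree_simple[OF W]
  \<comment> \<open>Neither block is \<open>{x}\<close> alone, as it would then be contained in the
    other.\<close>
  have other: "\<exists>b\<in>verts B. b \<noteq> x" if "block W B" "block W D" "B \<noteq> D" "x \<in> verts B" "x \<in> verts D" for B D
  proof (rule ccontr)
    assume "\<not> ?thesis"
    then have "verts B \<subseteq> verts D" using that(5) by (metis subsetI)
    then show False using clique_tree_block_eqI that by blast
  qed
  from other[OF B D ne x] other[OF D B ne[symmetric] x(2,1)]
  obtain b d where bd: "b \<in> verts B" "b \<noteq> x" "d \<in> verts D" "d \<noteq> x" by blast
  have ab: "adj W b x" using clique_tree_blockD[OF B bd(1) x(1) bd(2)] .
  have ad: "adj W x d" using clique_tree_blockD[OF D x(2) bd(3)] bd by simp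
  have "b \<noteq> d" using clique_tree_blocks_share[OF B D bd(2)] bd x ne by auto
  have "\<not> (adj (delete_vertex W x))\<^sup>*\<^sup>* b d"
  proof
    assume *: "(adj (delete_vertex W x))\<^sup>*\<^sup>* b d"
    from rtranclp_distinct_path[OF *] obtain p where
      p: "p \<noteq> []" "hd p = b" "last p = d" "distinct p" "successively (adj (delete_vertex W x)) p"
      by blast
    have d: "d \<in> verts (delete_vertex W x)" using bd block_verts_subset[OF D] by auto
    have v: "set p \<subseteq> verts W - {x}"
      using successively_adj_verts[OF simple_delete_vertex[OF G] p(5)] p(1,3) d by auto
    have "successively (adj W) p" using p(5) by (auto elim: successively_mono)
    moreover have "length p \<ge> 2" using p(1,2,3) \<open>b \<noteq> d\<close> by (cases p; cases "tl p") auto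
    moreover have "adj W x (hd p)" "adj W (last p) x"
      using p(2,3) adj_sym[OF ab] adj_sym[OF ad] by simp_all
    moreover have "x \<in> verts W" using x block_verts_subset[OF B] by blast
    moreover have "x \<notin> set p" "set p \<subseteq> verts W" using v by blast+
    ultimately have "cycle W (x # p)"
      using p(1,4) by (simp add: cycle_def successively_Cons)
    from clique_tree_clique_in_block[OF clique_tree_cycle_clique[OF this]]
    obtain E where E: "block W E" "set (x # p) \<subseteq> verts E" by auto
    have "b \<in> set p" "d \<in> set p" using p(1-3) by auto
    then have "{b, x} \<subseteq> verts E" "{d, x} \<subseteq> verts E" using E(2) by auto
    then have "B = E" "E = D"
      using clique_tree_blocks_share[OF B E(1) bd(2)] clique_tree_blocks_share[OF E(1) D bd(4)] bd x
      by simp_all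
    with ne show False by simp
  qed
  moreover have "(adj W)\<^sup>*\<^sup>* b d" using ab ad by (meson r_into_rtranclp rtranclp.rtrancl_into_rtrancl)
  moreover have "x \<in> verts W" "b \<in> verts W - {x}" "d \<in> verts W - {x}"
    using bd x block_verts_subset[OF B] block_verts_subset[OF D] by blast+
  ultimately show ?thesis
    unfolding cut_vertex_def joined_iff[OF G] joined_iff[OF simple_delete_vertex[OF G]] by blast
qed

end

section \<open>The canonical tree\<close>

lemma canonical_tree_adj [simp]:
  "adj (canonical_tree W) (Inl u) (Inl v) \<longleftrightarrow> False"
  "adj (canonical_tree W) (Inr B) (Inr D) \<longleftrightarrow> False"
  "adj (canonical_tree W) (Inl u) (Inr B) \<longleftrightarrow> block W B \<and> u \<in> verts B"
  "adj (canonical_tree W) (Inr B) (Inl u) \<longleftrightarrow> block W B \<and> u \<in> verts B"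
  by (auto simp: adj_def canonical_tree_def doubleton_eq_iff)

lemma verts_canonical_tree [simp]:
  "verts (canonical_tree W) = Inl ` verts W \<union> Inr ` {B. block W B}"
  by (simp add: canonical_tree_def)

text \<open>Turns the degree condition into the bound by block size used in both directions.\<close>

lemma degree_canonical_tree_Inr:
  assumes "block W B"
  shows "degree (canonical_tree W) (Inr B) = card (verts B)"
proof -
  have "adj (canonical_tree W) (Inr B) x \<longleftrightarrow> x \<in> Inl ` verts B" for x
    using assms by (cases x) auto
  then show ?thesis by (simp add: degree_def card_image)
qed

lemma clique_tree_finite_blocks:
  assumes "clique_tree W"
  shows "finite {B. block W B}"
proof (rule finite_imageD)
  have "verts ` {B. block W B} \<subseteq> Pow (verts W)" using block_verts_subset by blast
  then show "finite (verts ` {B. block W B})"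
    using clique_tree_simple[OF assms] by (meson finite_Pow_iff finite_subset simple_graph_def)
  show "inj_on verts {B. block W B}"
    using clique_tree_block_eqI[OF assms] by (auto simp: inj_on_def)
qed

lemma simple_canonical_tree:
  assumes "clique_tree W"
  shows "simple_graph (canonical_tree W)"
proof (rule simple_graphI)
  show "finite (verts (canonical_tree W))"
    using clique_tree_finite_blocks[OF assms] clique_tree_simple[OF assms]
    by (simp add: simple_graph_def)
  show "\<exists>x y. e = {x, y}" if "e \<in> edges (canonical_tree W)" for e
    using that by (auto simp: canonical_tree_def)
  show "x \<in> verts (canonical_tree W) \<and> y \<in> verts (canonical_tree W) \<and> x \<noteq> y"
    if "{x, y} \<in> edges (canonical_tree W)" for x y
  proof -
    have "adj (canonical_tree W) x y" using that by (simp add: adj_def)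
    then show ?thesis by (cases x; cases y) (auto dest: block_verts_subset)
  qed
qed

text \<open>The canonical tree is bipartite, so distance two stays on one side. The original
  vertices recover \<open>W\<close>; the new ones form the intersection graph of the blocks.\<close>

lemma canonical_tree_square_adj:
  assumes W: "clique_tree W"
  shows "adj (exact_dist_square (canonical_tree W)) (Inl u) (Inl v) \<longleftrightarrow> adj W u v"
    and "adj (exact_dist_square (canonical_tree W)) (Inr B) (Inr D) \<longleftrightarrow>
      B \<noteq> D \<and> block W B \<and> block W D \<and> verts B \<inter> verts D \<noteq> {}"
    and "\<not> adj (exact_dist_square (canonical_tree W)) (Inl u) (Inr B)"
    and "\<not> adj (exact_dist_square (canonical_tree W)) (Inr B) (Inl u)"
proof -
  have ex: "(\<exists>z. P z) \<longleftrightarrow> (\<exists>a. P (Inl a)) \<or> (\<exists>b. P (Inr b))" for P :: "'a + 'a ugraph \<Rightarrow> bool"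
    by (metis sum.exhaust)
  note sq = adj_exact_dist_square[OF simple_canonical_tree[OF W]]
  show "adj (exact_dist_square (canonical_tree W)) (Inl u) (Inl v) \<longleftrightarrow> adj W u v"
    unfolding sq ex clique_tree_adj_iff[OF W] by auto
  show "adj (exact_dist_square (canonical_tree W)) (Inr B) (Inr D) \<longleftrightarrow>
      B \<noteq> D \<and> block W B \<and> block W D \<and> verts B \<inter> verts D \<noteq> {}"
    unfolding sq ex by auto
  show "\<not> adj (exact_dist_square (canonical_tree W)) (Inl u) (Inr B)"
    "\<not> adj (exact_dist_square (canonical_tree W)) (Inr B) (Inl u)"
    unfolding sq ex by auto
qed

lemma connected_graph_invariant:
  assumes "simple_graph G" "connected_graph G" "a \<in> verts G" "P a" "b \<in> verts G"
    and "\<And>x y. adj G x y \<Longrightarrow> P x \<Longrightarrow> P y"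
  shows "P b"
  using connected_graphD[OF assms(1,2,3,5)] assms(4) by induction (auto intro: assms(6))

lemma connected_component_eqI:
  assumes "connected_component G C" "subgraph D G" "connected_graph D" "subgraph C D"
  shows "C = D"
  using assms by (auto simp: connected_component_def)

text \<open>Both sides of the bipartition induce connected subgraphs of the square and no edge joins
  them, so they are its components.\<close>

lemma canonical_tree_other_component:
  assumes W: "clique_tree W"
    and C: "connected_component (exact_dist_square (canonical_tree W)) C"
    and ne: "C \<noteq> graph_image Inl W"
  shows "verts C = Inr ` {B. block W B}"
    and "adj C (Inr B) (Inr D) \<longleftrightarrow>
      B \<noteq> D \<and> block W B \<and> block W D \<and> verts B \<inter> verts D \<noteq> {}"
proof -
  let ?S = "exact_dist_square (canonical_tree W)"
  let ?L = "induced_on ?S (Inl ` verts W)" and ?R = "induced_on ?S (Inr ` {B. block W B})"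
  note G = clique_tree_simple[OF W]
  note S = simple_exact_dist_square[OF simple_canonical_tree[OF W]]
  note sq = canonical_tree_square_adj[OF W]
  have CS: "subgraph C ?S" and simC: "simple_graph C" and conC: "connected_graph C"
    using C by (auto simp: connected_component_def subgraph_def)
  have simL: "simple_graph ?L" "subgraph ?L ?S" and simR: "simple_graph ?R" "subgraph ?R ?S"
    by (auto intro!: simple_induced_on subgraph_induced_on S)
  \<comment> \<open>Identifies the side of the original vertices with the graph that
    \<open>ne\<close> excludes.\<close>
  have L: "graph_image Inl W = ?L"
  proof (rule simple_graph_eqI[OF _ simL(1)])
    have a: "adj (graph_image Inl W) x y \<longleftrightarrow> (\<exists>u v. x = Inl u \<and> y = Inl v \<and> adj W u v)" for x y :: "'a + 'a ugraph"
    proof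
      assume "adj (graph_image Inl W) x y"
      then obtain e where e: "e \<in> edges W" "{x, y} = Inl ` e" by (auto simp: adj_def graph_image_def)
      then obtain u v where uv: "e = {u, v}" "adj W u v" using simple_graph_edgeE[OF G] by metis
      then have "x = Inl u \<and> y = Inl v \<or> x = Inl v \<and> y = Inl u"
        using e by (simp add: doubleton_eq_iff)
      with uv(2) adj_sym[OF uv(2)] show "\<exists>u v. x = Inl u \<and> y = Inl v \<and> adj W u v" by blast
    next
      assume "\<exists>u v. x = Inl u \<and> y = Inl v \<and> adj W u v"
      then obtain u v where "{u, v} \<in> edges W" "{x, y} = Inl ` {u, v}" by (auto simp: adj_def)
      then show "adj (graph_image Inl W) x y"
        unfolding adj_def graph_image_def ugraph.sel by (rule rev_image_eqI)
    qed
    show "adj (graph_image Inl W) x y = adj ?L x y" for x y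
      unfolding a by (auto simp: sq dest: simple_graph_adjD[OF G])
    show "simple_graph (graph_image Inl W :: ('a + 'a ugraph) ugraph)"
    proof (rule simple_graphI)
      show "finite (verts (graph_image Inl W))" using G by (simp add: simple_graph_def graph_image_def)
      show "\<exists>x y. e = {x, y}" if "e \<in> edges (graph_image Inl W)" for e :: "('a + 'a ugraph) set"
      proof -
        from that obtain e' where e': "e' \<in> edges W" "e = Inl ` e'" by (auto simp: graph_image_def)
        then obtain u v where "e' = {u, v}" using simple_graph_edgeE[OF G] by metis
        then have "e = {Inl u, Inl v}" using e' by auto
        then show ?thesis by blast
      qed
      show "x \<in> verts (graph_image Inl W) \<and> y \<in> verts (graph_image Inl W) \<and> x \<noteq> y"
        if "{x, y} \<in> edges (graph_image Inl W)" for x y :: "'a + 'a ugraph"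
      proof -
        have "adj (graph_image Inl W) x y" using that by (simp add: adj_def)
        then obtain u v where "x = Inl u" "y = Inl v" "adj W u v" unfolding a by blast
        with simple_graph_adjD[OF G, of u v] show ?thesis by (simp add: graph_image_def)
      qed
    qed
  qed (auto simp: graph_image_def)
  obtain u0 where u0: "u0 \<in> verts W"
    using clique_tree_connected[OF W] by (auto simp: connected_graph_def)
  have lift: "P v" if "u \<in> verts W" "v \<in> verts W" "P u" "\<And>x y. adj W x y \<Longrightarrow> P x \<Longrightarrow> P y" for P u v
    using connected_graph_invariant[OF G clique_tree_connected[OF W] that(1) _ that(2), of P] that(3,4)
    by blast
  have conL: "connected_graph ?L"
  proof (rule connected_graphI[OF simL(1), of "Inl u0"])
    fix x assume "x \<in> verts ?L"
    then obtain v where v: "x = Inl v" "v \<in> verts W" by auto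
    have "(adj ?L)\<^sup>*\<^sup>* (Inl u0) (Inl v)"
    proof (rule lift[OF u0 v(2)])
      fix y z assume yz: "adj W y z" and *: "(adj ?L)\<^sup>*\<^sup>* (Inl u0) (Inl y)"
      have "adj ?L (Inl y) (Inl z)" using yz simple_graph_adjD[OF G yz] by (simp add: sq)
      with * show "(adj ?L)\<^sup>*\<^sup>* (Inl u0) (Inl z)" by (rule rtranclp.rtrancl_into_rtrancl)
    qed simp
    then show "(adj ?L)\<^sup>*\<^sup>* (Inl u0) x" using v by simp
  qed (use u0 in simp)
  obtain B0 where B0: "block W B0" "u0 \<in> verts B0" using clique_tree_vertex_in_block[OF W u0] .
  have meet: "(adj ?R)\<^sup>*\<^sup>* (Inr B) (Inr D)" if "block W B" "block W D" "x \<in> verts B" "x \<in> verts D" for B D x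
  proof (cases "B = D")
    case False
    then have "adj ?R (Inr B) (Inr D)" using that by (auto simp: sq)
    then show ?thesis by blast
  qed simp
  have conR: "connected_graph ?R"
  proof (rule connected_graphI[OF simR(1), of "Inr B0"])
    fix x assume "x \<in> verts ?R"
    then obtain D where D: "x = Inr D" "block W D" by auto
    then obtain v where v: "v \<in> verts D" "v \<in> verts W"
      using block_verts_nonempty block_verts_subset by (metis ex_in_conv subsetD)
    \<comment> \<open>The claim moves along \<open>W\<close> for all blocks through a vertex at
      once: adjacent vertices share a block, and blocks through one vertex are adjacent in the
      square.\<close>
    have "\<forall>E. block W E \<and> v \<in> verts E \<longrightarrow> (adj ?R)\<^sup>*\<^sup>* (Inr B0) (Inr E)"
    proof (rule lift[OF u0 v(2)])
      show "\<forall>E. block W E \<and> u0 \<in> verts E \<longrightarrow> (adj ?R)\<^sup>*\<^sup>* (Inr B0) (Inr E)"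
        using meet B0 by blast
    next
      fix y z assume yz: "adj W y z"
        and *: "\<forall>E. block W E \<and> y \<in> verts E \<longrightarrow> (adj ?R)\<^sup>*\<^sup>* (Inr B0) (Inr E)"
      obtain E where "block W E" "y \<in> verts E" "z \<in> verts E"
        using yz clique_tree_adj_iff[OF W] by blast
      with * meet show "\<forall>E. block W E \<and> z \<in> verts E \<longrightarrow> (adj ?R)\<^sup>*\<^sup>* (Inr B0) (Inr E)"
        by (meson rtranclp_trans)
    qed
    then show "(adj ?R)\<^sup>*\<^sup>* (Inr B0) x" using D v by blast
  qed (use B0 in simp)
  have sub: "C = induced_on ?S A"
    if "subgraph (induced_on ?S A) ?S" "connected_graph (induced_on ?S A)" "verts C \<subseteq> A" for A
  proof (rule connected_component_eqI[OF C that(1,2)])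
    show "subgraph C (induced_on ?S A)"
      using that(3) simC subgraph_adj[OF CS] by (auto simp: subgraph_iff_adj dest: simple_graph_adjD)
  qed
  have vC: "verts C \<subseteq> Inl ` verts W \<union> Inr ` {B. block W B}" using CS by (auto simp: subgraph_def)
  obtain c where c: "c \<in> verts C" using conC by (auto simp: connected_graph_def)
  have isl: "isl x = isl c" if "x \<in> verts C" for x
  proof (rule connected_graph_invariant[OF simC conC c _ that])
    fix y z assume "adj C y z" and *: "isl y = isl c"
    then have "adj ?S y z" using subgraph_adj[OF CS] by blast
    then have "isl y = isl z" by (cases y; cases z) (simp_all add: sq)
    with * show "isl z = isl c" by simp
  qed simp
  have "verts C \<subseteq> Inl ` verts W \<or> verts C \<subseteq> Inr ` {B. block W B}"
  proof (cases "isl c")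
    case True
    have "verts C \<subseteq> Inl ` verts W"
    proof
      fix x assume x: "x \<in> verts C"
      have "isl x" using isl[OF x] True by simp
      moreover have "x \<in> Inl ` verts W \<union> Inr ` {B. block W B}" using vC x by (rule subsetD)
      ultimately show "x \<in> Inl ` verts W" by auto
    qed
    then show ?thesis by blast
  next
    case False
    have "verts C \<subseteq> Inr ` {B. block W B}"
    proof
      fix x assume x: "x \<in> verts C"
      have "\<not> isl x" using isl[OF x] False by simp
      moreover have "x \<in> Inl ` verts W \<union> Inr ` {B. block W B}" using vC x by (rule subsetD)
      ultimately show "x \<in> Inr ` {B. block W B}" by auto
    qed
    then show ?thesis by blast
  qed
  then have "C = ?R"
  proof
    assume "verts C \<subseteq> Inl ` verts W"
    from sub[OF simL(2) conL this] L ne show ?thesis by simp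
  qed (rule sub[OF simR(2) conR])
  then show "verts C = Inr ` {B. block W B}"
    "adj C (Inr B) (Inr D) \<longleftrightarrow>
      B \<noteq> D \<and> block W B \<and> block W D \<and> verts B \<inter> verts D \<noteq> {}"
    by (auto simp: sq)
qed

section \<open>Embeddings from trees\<close>

locale square_root_tree =
  fixes T W1 W2 :: "'a ugraph"
  assumes T: "tree T"
    and W1: "clique_tree W1" and W2: "clique_tree W2"
    and disjoint: "verts W1 \<inter> verts W2 = {}"
    and square: "exact_dist_square T = graph_union W1 W2"
begin

text \<open>The hypotheses are symmetric, so every fact about \<open>W1\<close> also serves for
  \<open>W2\<close>: under the interpretation \<open>sw\<close> below, \<open>sw.adj_W1_iff\<close>
  describes adjacency in \<open>W2\<close>.\<close>

lemma swap: "square_root_tree T W2 W1"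
  using T W1 W2 disjoint square
  by unfold_locales (auto simp: graph_union_def Un_commute)

lemma simple_T: "simple_graph T" and connected_T: "connected_graph T"
  and acyclic_T: "\<not> cycle T p"
  using T by (auto simp: tree_def)

lemma verts_T: "verts T = verts W1 \<union> verts W2"
  using arg_cong[OF square, of verts] by (simp add: graph_union_def)

lemma no_cycle:
  assumes "length p \<ge> 3" "distinct p" "successively (adj T) p" "adj T (last p) (hd p)"
  shows False
proof -
  have "last p \<in> verts T" "p \<noteq> []" using assms simple_graph_adjD[OF simple_T] by auto
  from successively_adj_verts[OF simple_T assms(3) this(2,1)] assms have "cycle T p"
    by (simp add: cycle_def)
  then show False using acyclic_T by blast
qed

text \<open>Distance exactly two also demands that \<open>x\<close> and \<open>y\<close> be
  nonadjacent, but with a common neighbour an edge would close a triangle.\<close>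

lemma adj_union: "adj W1 x y \<or> adj W2 x y \<longleftrightarrow> x \<noteq> y \<and> (\<exists>z. adj T x z \<and> adj T z y)"
proof -
  have "adj W1 x y \<or> adj W2 x y \<longleftrightarrow> adj (exact_dist_square T) x y"
    by (auto simp: square graph_union_def adj_def)
  moreover have False if "adj T x y" "adj T x z" "adj T z y" for z
    using no_cycle[of "[x, z, y]"] that simple_graph_adjD(3)[OF simple_T] adj_sym[OF that(1)] by auto
  ultimately show ?thesis by (auto simp: adj_exact_dist_square[OF simple_T])
qed

lemma common_neighbour_same_side:
  assumes "adj T x z" "adj T z y" "x \<in> verts W1"
  shows "y \<in> verts W1"
proof (cases "x = y")
  case False
  then have "adj W1 x y \<or> adj W2 x y" using adj_union assms by blast
  then show ?thesis using assms(3) disjoint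
      simple_graph_adjD[OF clique_tree_simple[OF W1]] simple_graph_adjD[OF clique_tree_simple[OF W2]]
    by blast
qed (use assms in simp)

text \<open>An edge inside \<open>W1\<close> would propagate along walks and force every vertex into \<open>W1\<close>.\<close>

lemma adj_T_sides:
  assumes "adj T x y" "x \<in> verts W1"
  shows "y \<in> verts W2"
proof (rule ccontr)
  assume "y \<notin> verts W2"
  then have y: "y \<in> verts W1" using simple_graph_adjD[OF simple_T assms(1)] verts_T by auto
  obtain w where w: "w \<in> verts W2"
    using clique_tree_connected[OF W2] by (auto simp: connected_graph_def)
  \<comment> \<open>The invariant carries a neighbour in \<open>W1\<close> along: it and the next
    vertex \<open>b\<close> share the neighbour \<open>a\<close>, so \<open>b\<close> is in
    \<open>W1\<close> as well.\<close>
  have "w \<in> verts W1 \<and> (\<exists>v\<in>verts W1. adj T w v)"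
  proof (rule connected_graph_invariant[OF simple_T connected_T, of x])
    show "x \<in> verts W1 \<and> (\<exists>v\<in>verts W1. adj T x v)" using assms y by blast
    show "x \<in> verts T" "w \<in> verts T" using w assms verts_T by auto
  next
    fix a b assume ab: "adj T a b" and a: "a \<in> verts W1 \<and> (\<exists>v\<in>verts W1. adj T a v)"
    then obtain v where v: "v \<in> verts W1" "adj T v a" using adj_sym by metis
    from common_neighbour_same_side[OF v(2) ab v(1)] a adj_sym[OF ab]
    show "b \<in> verts W1 \<and> (\<exists>v\<in>verts W1. adj T b v)" by blast
  qed
  then show False using w disjoint by blast
qed

lemma adj_W1_iff: "adj W1 x y \<longleftrightarrow> x \<in> verts W1 \<and> x \<noteq> y \<and> (\<exists>z. adj T x z \<and> adj T z y)"
proof -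
  have "\<not> adj W2 x y" if "x \<in> verts W1"
    using that disjoint simple_graph_adjD(1)[OF clique_tree_simple[OF W2], of x y] by blast
  moreover have "x \<in> verts W1" if "adj W1 x y"
    using simple_graph_adjD(1)[OF clique_tree_simple[OF W1] that] .
  ultimately show ?thesis using adj_union[of x y] by blast
qed

lemma common_neighbour_unique:
  assumes "adj T x w" "adj T y w" "adj T x w'" "adj T y w'" "x \<noteq> y"
  shows "w = w'"
proof (rule ccontr)
  assume "w \<noteq> w'"
  moreover have "x \<noteq> w" "x \<noteq> w'" "y \<noteq> w" "y \<noteq> w'"
    using assms simple_graph_adjD(3)[OF simple_T] by blast+
  ultimately show False
    using no_cycle[of "[x, w, y, w']"] assms adj_sym[OF assms(2)] adj_sym[OF assms(3)] by simp
qed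

lemma neighbours_clique:
  assumes "w \<in> verts W2"
  shows "clique W1 {u. adj T w u}"
proof -
  interpret sw: square_root_tree T W2 W1 by (rule swap)
  have side: "u \<in> verts W1" if "adj T w u" for u using sw.adj_T_sides[OF that assms] .
  have "adj W1 u v" if "adj T w u" "adj T w v" "u \<noteq> v" for u v
    using side that adj_sym[OF that(1)] adj_W1_iff by blast
  with side show ?thesis by (auto simp: clique_def)
qed

text \<open>Two vertices \<open>a\<close>, \<open>b\<close> of the block have a common neighbour
  \<open>w\<close>. A third vertex \<open>c\<close> not adjacent to \<open>w\<close> would be linked
  to \<open>a\<close> and \<open>b\<close> by other vertices, closing a 6-cycle. So \<open>w\<close>
  sees all of \<open>B\<close>, and since its neighbourhood is a clique, maximality gives
  equality.\<close>

lemma block_is_neighbourhood: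
  assumes B: "block W1 B"
  obtains w where "w \<in> verts W2" "{u. adj T w u} = verts B"
proof -
  interpret sw: square_root_tree T W2 W1 by (rule swap)
  note adjB = clique_tree_blockD[OF W1 B]
  obtain a where a: "a \<in> verts B" using block_verts_nonempty[OF B] by blast
  then have aW: "a \<in> verts W1" using block_verts_subset[OF B] by blast
  show thesis
  proof (cases "verts B = {a}")
    \<comment> \<open>A one-vertex block has no edge to supply \<open>w\<close>. Here
      \<open>W1\<close> consists of \<open>a\<close> alone, and any vertex of \<open>W2\<close> has
      just this neighbour.\<close>
    case True
    have na: "\<not> adj W1 a b" for b
    proof
      assume ab: "adj W1 a b"
      from clique_tree_block_maximal[OF W1 B clique_edge[OF clique_tree_simple[OF W1] ab]] True ab
      show False using simple_graph_adjD(3)[OF clique_tree_simple[OF W1]] by auto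
    qed
    have single: "x = a" if "x \<in> verts W1" for x
      using connected_graph_invariant[OF clique_tree_simple[OF W1] clique_tree_connected[OF W1] aW _ that,
          of "\<lambda>x. x = a"] na by blast
    obtain w where w: "w \<in> verts W2"
      using clique_tree_connected[OF W2] by (auto simp: connected_graph_def)
    have "(adj T)\<^sup>*\<^sup>* w a"
      using connected_graphD[OF simple_T connected_T] w aW verts_T by blast
    moreover have "w \<noteq> a" using w aW disjoint by blast
    ultimately obtain u where "adj T w u" by (meson converse_rtranclpE)
    then have "{u. adj T w u} = {a}" using sw.adj_T_sides[OF _ w] single by blast
    with that w True show thesis by simp
  next
    case False
    then obtain b where b: "b \<in> verts B" "a \<noteq> b" using a by blast
    obtain w where w: "adj T a w" "adj T w b" using adjB[OF a b] adj_W1_iff by blast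
    have wW: "w \<in> verts W2" using adj_T_sides[OF w(1) aW] .
    have "adj T w c" if c: "c \<in> verts B" for c
    proof (cases "c = a \<or> c = b")
      case True
      then show ?thesis using w(2) adj_sym[OF w(1)] by blast
    next
      case False
      obtain v where v: "adj T a v" "adj T v c" using adjB[OF a c] False adj_W1_iff by blast
      obtain v' where v': "adj T b v'" "adj T v' c" using adjB[OF b(1) c] False adj_W1_iff by blast
      show ?thesis
      proof (rule ccontr)
        assume nc: "\<not> adj T w c"
        then have ne: "w \<noteq> v" "w \<noteq> v'" using v v' by auto
        \<comment> \<open>Otherwise \<open>v\<close> would be a second common neighbour of
          \<open>a\<close> and \<open>b\<close>.\<close>
        have "v \<noteq> v'"
          using common_neighbour_unique[OF w(1) adj_sym[OF w(2)] v(1) _ b(2)] v'(1) ne(1) by blast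
        have "{a, b, c} \<subseteq> verts W1" using a b c block_verts_subset[OF B] by blast
        moreover have "{w, v, v'} \<subseteq> verts W2"
          using adj_T_sides w v v' \<open>{a, b, c} \<subseteq> verts W1\<close> by blast
        ultimately have "{a, b, c} \<inter> {w, v, v'} = {}" using disjoint by blast
        then have "distinct [a, w, b, v', c, v]" using ne \<open>v \<noteq> v'\<close> b False by auto
        moreover have "successively (adj T) [a, w, b, v', c, v]"
          using w v' adj_sym[OF v(2)] adj_sym[OF v'(1)] adj_sym[OF w(2)] by simp
        ultimately show False using no_cycle[of "[a, w, b, v', c, v]"] adj_sym[OF v(1)] by simp
      qed
    qed
    then have "verts B \<subseteq> {u. adj T w u}" by blast
    from clique_tree_block_maximal[OF W1 B neighbours_clique[OF wW] this] wW that
    show thesis by simp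
  qed
qed

text \<open>Two nonadjacent neighbours of \<open>w\<close> in \<open>W2\<close> are reached through
  different vertices of \<open>W1\<close>. These lie in \<open>B\<close> and have \<open>w\<close>
  as their only common neighbour. The conclusion is a uniqueness claim because the embedding is an
  arbitrary choice and must still hit every cut-vertex.\<close>

lemma cut_vertex_neighbourhood:
  assumes "cut_vertex W2 w"
  obtains B where "block W1 B" "\<And>w'. {u. adj T w' u} = verts B \<Longrightarrow> w' = w"
proof -
  interpret sw: square_root_tree T W2 W1 by (rule swap)
  have w: "w \<in> verts W2" using assms by (simp add: cut_vertex_def)
  obtain x y where xy: "adj W2 w x" "adj W2 w y" "x \<noteq> y" "\<not> adj W2 x y"
    using cut_vertex_nonadjacent_neighbours[OF clique_tree_simple[OF W2] assms] .
  obtain u v where uv: "adj T w u" "adj T u x" "adj T w v" "adj T v y"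
    using xy(1,2) unfolding sw.adj_W1_iff by blast
  have "x \<in> verts W2" using simple_graph_adjD[OF clique_tree_simple[OF W2] xy(1)] by simp
  then have "u \<noteq> v" using xy(3,4) uv(4) sw.adj_W1_iff[of x y] adj_sym[OF uv(2)] by blast
  obtain B where B: "block W1 B" "{u. adj T w u} \<subseteq> verts B"
    using clique_tree_clique_in_block[OF W1 neighbours_clique[OF w]] uv by blast
  show thesis
  proof (rule that[OF B(1)])
    fix w' assume "{u. adj T w' u} = verts B"
    then have "adj T w' u" "adj T w' v" using B(2) uv(1,3) by blast+
    from common_neighbour_unique[OF adj_sym[OF this(1)] adj_sym[OF this(2)] adj_sym[OF uv(1)] adj_sym[OF uv(3)] \<open>u \<noteq> v\<close>]
    show "w' = w" .
  qed
qed

lemma embedding_exists: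
  obtains f where "\<And>B. block W1 B \<Longrightarrow> f B \<in> verts W2"
    and "inj_on f {B. block W1 B}"
    and "\<And>B D. block W1 B \<Longrightarrow> block W1 D \<Longrightarrow>
      adj W2 (f B) (f D) \<longleftrightarrow> B \<noteq> D \<and> verts B \<inter> verts D \<noteq> {}"
    and "\<And>B. block W1 B \<Longrightarrow> card {D. block W2 D \<and> f B \<in> verts D} \<le> card (verts B)"
    and "\<And>w. cut_vertex W2 w \<Longrightarrow> \<exists>B. block W1 B \<and> w = f B"
proof -
  interpret sw: square_root_tree T W2 W1 by (rule swap)
  have "\<forall>B. \<exists>w. block W1 B \<longrightarrow> w \<in> verts W2 \<and> {u. adj T w u} = verts B"
    using block_is_neighbourhood by blast
  from choice[OF this] obtain f where f: "\<And>B. block W1 B \<Longrightarrow> f B \<in> verts W2"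
      "\<And>B. block W1 B \<Longrightarrow> {u. adj T (f B) u} = verts B"
    by blast
  \<comment> \<open>The blocks \<open>D\<close> through \<open>f B\<close> have their vertices
    \<open>h D\<close> adjacent to \<open>f B\<close>, so \<open>h\<close> injects these blocks into
    \<open>B\<close>: this is the degree condition.\<close>
  have "\<forall>D. \<exists>u. block W2 D \<longrightarrow> u \<in> verts W1 \<and> {w. adj T u w} = verts D"
    using sw.block_is_neighbourhood by blast
  from choice[OF this] obtain h where h: "\<And>D. block W2 D \<Longrightarrow> h D \<in> verts W1"
      "\<And>D. block W2 D \<Longrightarrow> {u. adj T (h D) u} = verts D"
    by blast
  have inj_f: "inj_on f {B. block W1 B}"
    using f(2) clique_tree_block_eqI[OF W1] by (auto simp: inj_on_def) (metis order_refl)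
  have inj_h: "inj_on h {D. block W2 D}"
    using h(2) clique_tree_block_eqI[OF W2] by (auto simp: inj_on_def) (metis order_refl)
  show thesis
  proof (rule that[of f])
    show "adj W2 (f B) (f D) \<longleftrightarrow> B \<noteq> D \<and> verts B \<inter> verts D \<noteq> {}"
      if "block W1 B" "block W1 D" for B D
    proof -
      have "f B = f D \<longleftrightarrow> B = D" using inj_f that by (auto simp: inj_on_def)
      then have "adj W2 (f B) (f D) \<longleftrightarrow> B \<noteq> D \<and> (\<exists>z. adj T (f B) z \<and> adj T (f D) z)"
        using f(1)[OF that(1)] sw.adj_W1_iff[of "f B" "f D"] adj_sym[of T _ "f D"] adj_sym[of T "f D"] by blast
      also have "\<dots> \<longleftrightarrow> B \<noteq> D \<and> verts B \<inter> verts D \<noteq> {}" using f(2) that by blast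
      finally show ?thesis .
    qed
    show "card {D. block W2 D \<and> f B \<in> verts D} \<le> card (verts B)" if B: "block W1 B" for B
    proof (rule card_inj_on_le)
      show "inj_on h {D. block W2 D \<and> f B \<in> verts D}" using inj_h by (rule inj_on_subset) blast
      show "h ` {D. block W2 D \<and> f B \<in> verts D} \<subseteq> verts B"
      proof clarify
        fix D assume D: "block W2 D" "f B \<in> verts D"
        then have "adj T (h D) (f B)" using h(2) by blast
        from adj_sym[OF this] show "h D \<in> verts B" using f(2)[OF B] by blast
      qed
      show "finite (verts B)"
        using block_verts_subset[OF B] clique_tree_simple[OF W1] by (auto simp: simple_graph_def intro: finite_subset)
    qed
    show "\<exists>B. block W1 B \<and> w = f B" if w: "cut_vertex W2 w" for w
    proof -
      obtain B where "block W1 B" "\<And>w'. {u. adj T w' u} = verts B \<Longrightarrow> w' = w"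
        using cut_vertex_neighbourhood[OF w] by blast
      with f(2) show ?thesis by metis
    qed
  qed (use f inj_f in auto)
qed

end

section \<open>Trees from embeddings\<close>

locale block_embedding =
  fixes W1 W2 :: "'a ugraph" and f :: "'a ugraph \<Rightarrow> 'a"
  assumes W1: "clique_tree W1" and W2: "clique_tree W2"
    and f_in: "block W1 B \<Longrightarrow> f B \<in> verts W2"
    and f_inj: "block W1 B \<Longrightarrow> block W1 D \<Longrightarrow> f B = f D \<Longrightarrow> B = D"
    and f_adj: "block W1 B \<Longrightarrow> block W1 D \<Longrightarrow>
      adj W2 (f B) (f D) \<longleftrightarrow> B \<noteq> D \<and> verts B \<inter> verts D \<noteq> {}"
    and f_card: "block W1 B \<Longrightarrow> card {D. block W2 D \<and> f B \<in> verts D} \<le> card (verts B)"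
    and f_cut: "cut_vertex W2 w \<Longrightarrow> \<exists>B. block W1 B \<and> w = f B"
begin

lemma simple_W1: "simple_graph W1" and simple_W2: "simple_graph W2"
  using W1 W2 by (simp_all add: clique_tree_simple)

text \<open>If \<open>D\<close> shares a vertex with another block, that vertex is a cut-vertex and
  lies in the image. Otherwise \<open>D\<close> fills all of \<open>W2\<close> and contains the
  image of any block.\<close>

lemma block_meets_image:
  assumes D: "block W2 D"
  obtains B where "block W1 B" "f B \<in> verts D"
proof (cases "\<exists>x D'. x \<in> verts D \<and> block W2 D' \<and> D \<noteq> D' \<and> x \<in> verts D'")
  case True
  then obtain x D' where x: "x \<in> verts D" "block W2 D'" "D \<noteq> D'" "x \<in> verts D'" by blast
  from f_cut[OF clique_tree_two_blocks_cut_vertex[OF W2 D x(2,3,1,4)]] x(1) that show thesis by blast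
next
  case False
  obtain x where x: "x \<in> verts D" using block_verts_nonempty[OF D] by blast
  then have xW: "x \<in> verts W2" using block_verts_subset[OF D] by blast
  have all: "y \<in> verts D" if y: "y \<in> verts W2" for y
  proof (rule connected_graph_invariant[where P = "\<lambda>z. z \<in> verts D", OF simple_W2 clique_tree_connected[OF W2] xW x y])
    show "b \<in> verts D" if "adj W2 a b" "a \<in> verts D" for a b
      using that False clique_tree_adj_iff[OF W2, of a b] by blast
  qed
  obtain u where "u \<in> verts W1" using clique_tree_connected[OF W1] by (auto simp: connected_graph_def)
  then obtain B where "block W1 B" using clique_tree_vertex_in_block[OF W1] by blast
  then show thesis using that all f_in by blast
qed

section \<open>The vertex of \<open>W1\<close> assigned to each block of \<open>W2\<close>\<close>

lemma image_block:
  assumes "block W1 B" "block W1 B'" "B \<noteq> B'" "u \<in> verts B" "u \<in> verts B'"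
  obtains D where "block W2 D" "f B \<in> verts D" "f B' \<in> verts D"
proof -
  have "adj W2 (f B) (f B')" using f_adj[OF assms(1,2)] assms(3-5) by blast
  then show thesis using that clique_tree_adj_iff[OF W2, of "f B" "f B'"] by blast
qed

text \<open>Relies on the direction of \<open>f_adj\<close> that fails for embeddings that are not
  induced.\<close>

lemma image_common_vertex:
  assumes "block W2 D" "block W1 B" "block W1 B'" "f B \<in> verts D" "f B' \<in> verts D"
  obtains u where "u \<in> verts B" "u \<in> verts B'"
proof (cases "B = B'")
  case True
  then show thesis using that block_verts_nonempty[OF assms(2)] by blast
next
  case False
  then have "f B \<noteq> f B'" using f_inj assms by blast
  then have "adj W2 (f B) (f B')" using clique_tree_blockD[OF W2 assms(1)] assms(4,5) by blast
  then show thesis using that f_adj[OF assms(2,3)] by blast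
qed

text \<open>The blocks of \<open>W2\<close> whose assigned vertex is forced: it must lie in
  \<open>B\<close> and in \<open>B'\<close>, which meet in one vertex.\<close>

definition shared :: "'a ugraph \<Rightarrow> bool" where
  "shared D \<longleftrightarrow> (\<exists>B B'. block W1 B \<and> block W1 B' \<and> B \<noteq> B' \<and> f B \<in> verts D \<and> f B' \<in> verts D)"

text \<open>These turn out to be exactly the forced vertices. Blocks that are not shared get
  vertices outside this set, so the two kinds cannot collide.\<close>

definition overlap :: "'a set" where
  "overlap = {u. \<exists>B B'. block W1 B \<and> block W1 B' \<and> B \<noteq> B' \<and> u \<in> verts B \<and> u \<in> verts B'}"

text \<open>Pairwise intersecting blocks of a clique tree have a common vertex.\<close>

lemma shared_common_vertex:
  assumes D: "block W2 D" and sh: "shared D"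
  shows "\<exists>u\<in>overlap. \<forall>B. block W1 B \<and> f B \<in> verts D \<longrightarrow> u \<in> verts B"
proof -
  obtain B1 B2 where B1: "block W1 B1" "f B1 \<in> verts D" and B2: "block W1 B2" "f B2 \<in> verts D"
    and ne: "B1 \<noteq> B2" using sh by (auto simp: shared_def)
  obtain u where u: "u \<in> verts B1" "u \<in> verts B2"
    using image_common_vertex[OF D B1(1) B2(1) B1(2) B2(2)] .
  \<comment> \<open>If \<open>B3\<close> missed \<open>u\<close>, its meeting points with
    \<open>B1\<close> and \<open>B2\<close> would form a triangle with \<open>u\<close>; a block
    containing it shares two vertices with each of \<open>B1\<close> and \<open>B2\<close>, making
    them equal.\<close>
  have "u \<in> verts B3" if B3: "block W1 B3" "f B3 \<in> verts D" for B3
  proof (rule ccontr)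
    assume nu: "u \<notin> verts B3"
    obtain a where a: "a \<in> verts B1" "a \<in> verts B3"
      using image_common_vertex[OF D B1(1) B3(1) B1(2) B3(2)] .
    obtain b where b: "b \<in> verts B2" "b \<in> verts B3"
      using image_common_vertex[OF D B2(1) B3(1) B2(2) B3(2)] .
    have au: "a \<noteq> u" and bu: "b \<noteq> u" using a b nu by auto
    have ab: "a \<noteq> b" using clique_tree_blocks_share[OF W1 B1(1) B2(1) au] a b u ne by auto
    have "adj W1 a u" "adj W1 b u" "adj W1 a b"
      using clique_tree_blockD[OF W1 B1(1) a(1) u(1) au] clique_tree_blockD[OF W1 B2(1) b(1) u(2) bu]
        clique_tree_blockD[OF W1 B3(1) a(2) b(2) ab] .
    moreover have "{u, a, b} \<subseteq> verts W1"
      using a b u block_verts_subset[OF B1(1)] block_verts_subset[OF B2(1)] by blast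
    ultimately have "clique W1 {u, a, b}"
      using adj_sym[of W1 a u] adj_sym[of W1 b u] adj_sym[of W1 a b] by (simp add: clique_def)
    then obtain E where E: "block W1 E" "{u, a, b} \<subseteq> verts E"
      using clique_tree_clique_in_block[OF W1] by blast
    have "B1 = E" using clique_tree_blocks_share[OF W1 B1(1) E(1) au] a u E by simp
    moreover have "B2 = E" using clique_tree_blocks_share[OF W1 B2(1) E(1) bu] b u E by simp
    ultimately show False using ne by simp
  qed
  moreover have "u \<in> overlap" using B1 B2 ne u by (auto simp: overlap_def)
  ultimately show ?thesis by blast
qed

text \<open>The images of the three blocks through \<open>u\<close> are pairwise adjacent, so they
  lie in one block, which shares \<open>f B1\<close> and \<open>f B2\<close> with \<open>D\<close>.
  This serves to show that different shared blocks force different vertices.\<close>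

lemma image_in_shared_block:
  assumes D: "block W2 D" and B1: "block W1 B1" "f B1 \<in> verts D" and B2: "block W1 B2" "f B2 \<in> verts D"
    and ne: "B1 \<noteq> B2" and B3: "block W1 B3" and u: "u \<in> verts B1" "u \<in> verts B2" "u \<in> verts B3"
  shows "f B3 \<in> verts D"
proof -
  have "clique W2 (f ` {B1, B2, B3})"
    unfolding clique_def
  proof (intro conjI ballI impI)
    show "f ` {B1, B2, B3} \<subseteq> verts W2" using f_in B1 B2 B3 by blast
    fix x y assume "x \<in> f ` {B1, B2, B3}" "y \<in> f ` {B1, B2, B3}" "x \<noteq> y"
    then obtain B B' where "x = f B" "y = f B'" "B \<in> {B1, B2, B3}" "B' \<in> {B1, B2, B3}" "B \<noteq> B'"
      by blast
    moreover from this have "block W1 B" "block W1 B'" "u \<in> verts B" "u \<in> verts B'"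
      using B1 B2 B3 u by blast+
    ultimately show "adj W2 x y" using f_adj by blast
  qed
  then obtain E where E: "block W2 E" "f ` {B1, B2, B3} \<subseteq> verts E"
    using clique_tree_clique_in_block[OF W2] by blast
  have "f B1 \<noteq> f B2" using f_inj B1 B2 ne by blast
  from clique_tree_blocks_share[OF W2 D E(1) this] B1 B2 E show ?thesis by simp
qed

text \<open>A block of \<open>W2\<close> containing two image vertices must be attached to the common vertex of the
  corresponding blocks of \<open>W1\<close>; one containing only \<open>f B\<close> can be attached to any vertex lying
  in no block but \<open>B\<close>, and the degree condition says that there are enough of these.\<close>

lemma assignment_exists:
  obtains g where "inj_on g {D. block W2 D}"
    and "\<And>B D. block W1 B \<Longrightarrow> block W2 D \<Longrightarrow> f B \<in> verts D \<Longrightarrow> g D \<in> verts B"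
proof -
  have "\<forall>D. \<exists>u. block W2 D \<and> shared D \<longrightarrow>
      u \<in> overlap \<and> (\<forall>B. block W1 B \<and> f B \<in> verts D \<longrightarrow> u \<in> verts B)"
    using shared_common_vertex by blast
  from choice[OF this] obtain c where c: "\<And>D. block W2 D \<Longrightarrow> shared D \<Longrightarrow> c D \<in> overlap"
    "\<And>D B. block W2 D \<Longrightarrow> shared D \<Longrightarrow> block W1 B \<Longrightarrow> f B \<in> verts D \<Longrightarrow> c D \<in> verts B"
    by blast
  have c_inj: "D = D'" if D: "block W2 D" "shared D" and D': "block W2 D'" "shared D'" and eq: "c D = c D'" for D D'
  proof -
    obtain B1 B2 where B: "block W1 B1" "f B1 \<in> verts D" "block W1 B2" "f B2 \<in> verts D" "B1 \<noteq> B2"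
      using D by (auto simp: shared_def)
    obtain B1' B2' where B': "block W1 B1'" "f B1' \<in> verts D'" "block W1 B2'" "f B2' \<in> verts D'" "B1' \<noteq> B2'"
      using D' by (auto simp: shared_def)
    have u: "c D \<in> verts B1" "c D \<in> verts B2" "c D \<in> verts B1'" "c D \<in> verts B2'"
      using c(2)[OF D] c(2)[OF D'] B B' unfolding eq by blast+
    have "f B1' \<in> verts D" "f B2' \<in> verts D"
      using image_in_shared_block[OF D(1) B(1-5) B'(1) u(1-3)]
        image_in_shared_block[OF D(1) B(1-5) B'(3) u(1,2,4)] .
    moreover have "f B1' \<noteq> f B2'" using f_inj B' by blast
    ultimately show ?thesis using clique_tree_blocks_share[OF W2 D(1) D'(1)] B' by blast
  qed
  let ?P = "\<lambda>B. {D. block W2 D \<and> f B \<in> verts D \<and> \<not> shared D}"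
  have "\<exists>h. inj_on h (?P B) \<and> h ` ?P B \<subseteq> verts B - overlap" if B: "block W1 B" for B
  proof -
    let ?S = "{D. block W2 D \<and> f B \<in> verts D \<and> shared D}"
    have fin: "finite ?S" "finite (?P B)"
      using clique_tree_finite_blocks[OF W2] by (auto elim: rev_finite_subset)
    have finB: "finite (verts B)"
      using block_verts_subset[OF B] simple_W1 by (auto simp: simple_graph_def intro: finite_subset)
    have "{D. block W2 D \<and> f B \<in> verts D} = ?S \<union> ?P B" by blast
    then have "card ?S + card (?P B) \<le> card (verts B)"
      using f_card[OF B] card_Un_disjoint[OF fin] by fastforce
    \<comment> \<open>Each vertex of \<open>B\<close> in \<open>overlap\<close> is forced by a
      shared block through \<open>f B\<close>; the degree bound then leaves enough of
      \<open>B\<close> for the blocks that are not shared.\<close>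
    moreover have "card (verts B \<inter> overlap) \<le> card ?S"
    proof (rule surj_card_le[OF fin(1)])
      show "verts B \<inter> overlap \<subseteq> c ` ?S"
      proof
        fix u assume u: "u \<in> verts B \<inter> overlap"
        then obtain B' where B': "block W1 B'" "B \<noteq> B'" "u \<in> verts B'" unfolding overlap_def by blast
        obtain D where D: "block W2 D" "f B \<in> verts D" "f B' \<in> verts D"
          using image_block[OF B B'(1,2) _ B'(3)] u by blast
        have sh: "shared D" using B B' D unfolding shared_def by blast
        have "c D \<in> verts B" "c D \<in> verts B'" using c(2)[OF D(1) sh] B B' D by blast+
        then have "c D = u" using clique_tree_blocks_share[OF W1 B B'(1), of "c D" u] u B' by blast
        then show "u \<in> c ` ?S" using D sh by blast
      qed
    qed
    moreover have "card (verts B) = card (verts B \<inter> overlap) + card (verts B - overlap)"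
      using card_Int_Diff[OF finB] .
    ultimately have "card (?P B) \<le> card (verts B - overlap)" by linarith
    then show ?thesis using inj_on_iff_card_le[OF fin(2)] finB by blast
  qed
  then have "\<forall>B. \<exists>h. block W1 B \<longrightarrow> inj_on h (?P B) \<and> h ` ?P B \<subseteq> verts B - overlap" by blast
  from choice[OF this] obtain h where h: "\<And>B. block W1 B \<Longrightarrow> inj_on (h B) (?P B)"
      "\<And>B. block W1 B \<Longrightarrow> h B ` ?P B \<subseteq> verts B - overlap" by blast
  \<comment> \<open>For a block that is not shared, \<open>b D\<close> is the only block of
    \<open>W1\<close> whose image it contains.\<close>
  have "\<forall>D. \<exists>B. block W2 D \<longrightarrow> block W1 B \<and> f B \<in> verts D" using block_meets_image by blast
  from choice[OF this] obtain b where b: "\<And>D. block W2 D \<Longrightarrow> block W1 (b D)"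
      "\<And>D. block W2 D \<Longrightarrow> f (b D) \<in> verts D" by blast
  define g where "g D = (if shared D then c D else h (b D) D)" for D
  have gU: "g D \<in> overlap \<longleftrightarrow> shared D" and g_private: "\<not> shared D \<Longrightarrow> g D \<in> verts (b D)"
    if D: "block W2 D" for D
  proof -
    have *: "h (b D) D \<in> verts (b D) - overlap" if "\<not> shared D"
      using h(2)[OF b(1)[OF D]] b(2)[OF D] D that by blast
    then show "g D \<in> overlap \<longleftrightarrow> shared D" using c(1)[OF D] by (auto simp: g_def)
    show "g D \<in> verts (b D)" if "\<not> shared D" using * that by (simp add: g_def)
  qed
  show thesis
  proof (rule that[of g])
    fix B D assume B: "block W1 B" and D: "block W2 D" and fB: "f B \<in> verts D"
    show "g D \<in> verts B"
    proof (cases "shared D")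
      case True
      then show ?thesis using c(2) B D fB by (simp add: g_def)
    next
      case False
      then have "b D = B" using B D fB b unfolding shared_def by blast
      then show ?thesis using g_private[OF D False] by simp
    qed
  next
    show "inj_on g {D. block W2 D}"
    proof (rule inj_onI)
      fix D D' assume "D \<in> {D. block W2 D}" "D' \<in> {D. block W2 D}" and eq: "g D = g D'"
      then have D: "block W2 D" and D': "block W2 D'" by auto
      have sh: "shared D \<longleftrightarrow> shared D'" using gU[OF D] gU[OF D'] eq by simp
      show "D = D'"
      proof (cases "shared D")
        case True
        then show ?thesis using c_inj[OF D _ D'] sh eq by (simp add: g_def)
      next
        case False
        have "b D = b D'"
        proof (rule ccontr)
          \<comment> \<open>The common value would lie in two blocks of \<open>W1\<close>, hence in
            \<open>overlap\<close>.\<close>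
          assume "b D \<noteq> b D'"
          then have "g D \<in> overlap"
            using g_private[OF D False] g_private[OF D'] sh False eq b(1)[OF D] b(1)[OF D']
            unfolding overlap_def by (metis (mono_tags, lifting) mem_Collect_eq)
          then show False using gU[OF D] False by simp
        qed
        then have "h (b D) D = h (b D) D'" using eq False sh by (simp add: g_def)
        moreover have "D \<in> ?P (b D)" "D' \<in> ?P (b D)"
          using D D' False sh b(2)[OF D] b(2)[OF D'] \<open>b D = b D'\<close> by simp_all
        ultimately show ?thesis using inj_onD[OF h(1)[OF b(1)[OF D]]] by blast
      qed
    qed
  qed
qed

end

section \<open>The tree glued from the two canonical trees\<close>

locale block_assignment = block_embedding W1 W2 f
  for W1 W2 :: "'a ugraph" and f :: "'a ugraph \<Rightarrow> 'a" +
  fixes g :: "'a ugraph \<Rightarrow> 'a"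
  assumes g_inj: "block W2 D \<Longrightarrow> block W2 D' \<Longrightarrow> g D = g D' \<Longrightarrow> D = D'"
    and g_in: "block W1 B \<Longrightarrow> block W2 D \<Longrightarrow> f B \<in> verts D \<Longrightarrow> g D \<in> verts B"
    and disjoint: "verts W1 \<inter> verts W2 = {}"
begin

text \<open>The edges of the two canonical trees after gluing, oriented from \<open>W1\<close> to
  \<open>W2\<close>; both disjuncts may describe the same edge.\<close>

definition nbr :: "'a \<Rightarrow> 'a \<Rightarrow> bool" where
  "nbr u w \<longleftrightarrow> (\<exists>D. block W2 D \<and> g D = u \<and> w \<in> verts D) \<or> (\<exists>B. block W1 B \<and> u \<in> verts B \<and> w = f B)"

definition T :: "'a ugraph" where
  "T = Graph (verts W1 \<union> verts W2) {{u, w} | u w. nbr u w}"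

lemma g_verts: "block W2 D \<Longrightarrow> g D \<in> verts W1"
  using block_meets_image g_in block_verts_subset by (metis subsetD)

lemma nbr_verts:
  assumes "nbr u w"
  shows "u \<in> verts W1" "w \<in> verts W2"
  using assms g_verts f_in block_verts_subset unfolding nbr_def by blast+

text \<open>For a block \<open>D\<close> containing both images, \<open>g D\<close> lies in
  \<open>B\<close> and in \<open>B'\<close>, which meet only in \<open>u\<close>.\<close>

lemma common_vertex_assigned:
  assumes "block W1 B" "block W1 B'" "B \<noteq> B'" "u \<in> verts B" "u \<in> verts B'"
  obtains D where "block W2 D" "g D = u" "f B \<in> verts D" "f B' \<in> verts D"
proof -
  obtain D where D: "block W2 D" "f B \<in> verts D" "f B' \<in> verts D"
    using image_block[OF assms] .
  have "g D \<in> verts B" "g D \<in> verts B'" using g_in D assms by blast+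
  then have "g D = u" using clique_tree_blocks_share[OF W1 assms(1,2), of "g D" u] assms by blast
  with D that show thesis by blast
qed

text \<open>Gluing adds no neighbour to \<open>f B\<close>: if \<open>f B\<close> lies in
  \<open>D\<close>, then \<open>g D\<close> already lies in \<open>B\<close>.\<close>

lemma nbr_image: "block W1 B \<Longrightarrow> nbr u (f B) \<longleftrightarrow> u \<in> verts B"
  using g_in f_inj unfolding nbr_def by blast

lemma nbr_g:
  assumes D: "block W2 D"
  shows "nbr (g D) w \<longleftrightarrow> w \<in> verts D"
proof
  assume "nbr (g D) w"
  then consider D' where "block W2 D'" "g D' = g D" "w \<in> verts D'"
    | B where "block W1 B" "g D \<in> verts B" "w = f B" unfolding nbr_def by blast
  then show "w \<in> verts D"
  proof cases
    case 1
    then show ?thesis using g_inj D by blast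
  next
    case 2
    \<comment> \<open>\<open>g D\<close> lies in \<open>B0\<close> by \<open>g_in\<close>. Another
      block \<open>B\<close> through \<open>g D\<close> has its image, with that of
      \<open>B0\<close>, in a block assigned to \<open>g D\<close>, and this is \<open>D\<close>
      because \<open>g\<close> is injective.\<close>
    obtain B0 where B0: "block W1 B0" "f B0 \<in> verts D" using block_meets_image[OF D] .
    have g0: "g D \<in> verts B0" using g_in B0 D by blast
    show ?thesis
    proof (cases "B = B0")
      case False
      obtain D' where "block W2 D'" "g D' = g D" "f B \<in> verts D'"
        using common_vertex_assigned[OF 2(1) B0(1) False 2(2) g0] .
      then show ?thesis using g_inj D 2 by blast
    qed (use 2 B0 in simp)
  qed
qed (use D in \<open>auto simp: nbr_def\<close>)

text \<open>A vertex outside the range of \<open>g\<close> is joined only to images of blocks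
  containing it; two of these would make it a value of \<open>g\<close>.\<close>

lemma nbr_two:
  assumes "nbr u w" "nbr u w'" "w \<noteq> w'"
  obtains D where "block W2 D" "g D = u" "w \<in> verts D" "w' \<in> verts D"
proof -
  have "\<exists>D. block W2 D \<and> g D = u"
  proof (rule ccontr)
    assume no: "\<not> ?thesis"
    then obtain B B' where "block W1 B" "u \<in> verts B" "w = f B" "block W1 B'" "u \<in> verts B'" "w' = f B'"
      using assms unfolding nbr_def by blast
    then show False using common_vertex_assigned[of B B' u] assms no by blast
  qed
  then show thesis using nbr_g assms that by blast
qed

lemma adj_W2_iff_nbr: "adj W2 w w' \<longleftrightarrow> w \<noteq> w' \<and> (\<exists>u. nbr u w \<and> nbr u w')"
proof
  assume "adj W2 w w'"
  then obtain D where "block W2 D" "w \<in> verts D" "w' \<in> verts D" "w \<noteq> w'"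
    using clique_tree_adj_iff[OF W2, of w w'] by blast
  then show "w \<noteq> w' \<and> (\<exists>u. nbr u w \<and> nbr u w')" using nbr_g by blast
next
  assume "w \<noteq> w' \<and> (\<exists>u. nbr u w \<and> nbr u w')"
  then obtain D where "block W2 D" "w \<in> verts D" "w' \<in> verts D" "w \<noteq> w'" using nbr_two by blast
  then show "adj W2 w w'" using clique_tree_adj_iff[OF W2, of w w'] by blast
qed

lemma adj_W1_iff_nbr: "adj W1 u v \<longleftrightarrow> u \<noteq> v \<and> (\<exists>w. nbr u w \<and> nbr v w)"
proof
  assume "adj W1 u v"
  then obtain B where "block W1 B" "u \<in> verts B" "v \<in> verts B" "u \<noteq> v"
    using clique_tree_adj_iff[OF W1, of u v] by blast
  then show "u \<noteq> v \<and> (\<exists>w. nbr u w \<and> nbr v w)" using nbr_image by blast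
next
  assume "u \<noteq> v \<and> (\<exists>w. nbr u w \<and> nbr v w)"
  then obtain w where uv: "u \<noteq> v" and w: "nbr u w" "nbr v w" by blast
  \<comment> \<open>Outside the image, \<open>w\<close> is joined only to vertices
    \<open>g D\<close> of blocks through it. Two of them make \<open>w\<close> a cut-vertex, and
    these lie in the image.\<close>
  have "\<exists>B. block W1 B \<and> w = f B"
  proof (rule ccontr)
    assume no: "\<not> ?thesis"
    then obtain D D' where D: "block W2 D" "g D = u" "w \<in> verts D" "block W2 D'" "g D' = v" "w \<in> verts D'"
      using w unfolding nbr_def by blast
    then have "D \<noteq> D'" using uv by blast
    from f_cut[OF clique_tree_two_blocks_cut_vertex[OF W2 D(1,4) this D(3,6)]] no show False by blast
  qed
  then obtain B where "block W1 B" "w = f B" by blast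
  then have "u \<in> verts B" "v \<in> verts B" using w nbr_image by blast+
  then show "adj W1 u v" using clique_tree_adj_iff[OF W1, of u v] uv \<open>block W1 B\<close> by blast
qed

lemma verts_T: "verts T = verts W1 \<union> verts W2"
  by (simp add: T_def)

lemma adj_T: "adj T x y \<longleftrightarrow> nbr x y \<or> nbr y x"
  unfolding adj_def T_def by (auto simp: doubleton_eq_iff)

lemma simple_T: "simple_graph T"
proof (rule simple_graphI)
  show "finite (verts T)" using simple_W1 simple_W2 by (simp add: verts_T simple_graph_def)
  show "\<exists>x y. e = {x, y}" if "e \<in> edges T" for e using that by (auto simp: T_def)
  show "x \<in> verts T \<and> y \<in> verts T \<and> x \<noteq> y" if "{x, y} \<in> edges T" for x y
  proof -
    have "nbr x y \<or> nbr y x" using that adj_T[of x y] by (simp add: adj_def)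
    then show ?thesis using nbr_verts disjoint unfolding verts_T by blast
  qed
qed

lemma adj_T_side:
  "x \<in> verts W1 \<Longrightarrow> adj T x y \<longleftrightarrow> nbr x y"
  "x \<in> verts W2 \<Longrightarrow> adj T x y \<longleftrightarrow> nbr y x"
  using nbr_verts disjoint unfolding adj_T by blast+

lemma common_neighbour_T:
  "(\<exists>z. adj T x z \<and> adj T z y) \<longleftrightarrow> (\<exists>w. nbr x w \<and> nbr y w) \<or> (\<exists>u. nbr u x \<and> nbr u y)"
proof
  assume "\<exists>z. adj T x z \<and> adj T z y"
  then obtain z where z: "nbr x z \<or> nbr z x" "nbr z y \<or> nbr y z" unfolding adj_T by blast
  then show "(\<exists>w. nbr x w \<and> nbr y w) \<or> (\<exists>u. nbr u x \<and> nbr u y)"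
    using nbr_verts[of x z] nbr_verts[of z x] nbr_verts[of z y] nbr_verts[of y z] disjoint by blast
qed (auto simp: adj_T)

lemma square_T: "exact_dist_square T = graph_union W1 W2"
proof (rule simple_graph_eqI[OF simple_exact_dist_square[OF simple_T]])
  show "simple_graph (graph_union W1 W2)"
    using simple_W1 simple_W2 by (auto simp: simple_graph_def graph_union_def)
  show "verts (exact_dist_square T) = verts (graph_union W1 W2)"
    by (simp add: verts_T graph_union_def)
  fix x y
  have "adj (graph_union W1 W2) x y \<longleftrightarrow> adj W1 x y \<or> adj W2 x y"
    by (auto simp: adj_def graph_union_def)
  also have "\<dots> \<longleftrightarrow> x \<noteq> y \<and> (\<exists>z. adj T x z \<and> adj T z y)"
    unfolding adj_W1_iff_nbr adj_W2_iff_nbr common_neighbour_T by blast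
  also have "\<dots> \<longleftrightarrow> x \<noteq> y \<and> \<not> adj T x y \<and> (\<exists>z. adj T x z \<and> adj T z y)"
  proof -
    \<comment> \<open>A common neighbour puts \<open>x\<close> and \<open>y\<close> on the same
      side, while edges of \<open>T\<close> join different sides.\<close>
    have "\<not> adj T x y" if "\<exists>z. adj T x z \<and> adj T z y"
      using that nbr_verts disjoint unfolding common_neighbour_T adj_T by blast
    then show ?thesis by blast
  qed
  finally show "adj (exact_dist_square T) x y = adj (graph_union W1 W2) x y"
    unfolding adj_exact_dist_square[OF simple_T] by blast
qed

lemma connected_T: "connected_graph T"
proof -
  obtain u0 where u0: "u0 \<in> verts W1"
    using clique_tree_connected[OF W1] by (auto simp: connected_graph_def)
  have reach1: "(adj T)\<^sup>*\<^sup>* u0 u" if u: "u \<in> verts W1" for u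
  proof (rule connected_graph_invariant[OF simple_W1 clique_tree_connected[OF W1] u0 _ u])
    fix x y assume "adj W1 x y" and *: "(adj T)\<^sup>*\<^sup>* u0 x"
    then obtain w where "adj T x w" "adj T w y" unfolding adj_W1_iff_nbr adj_T by blast
    with * show "(adj T)\<^sup>*\<^sup>* u0 y" by (meson rtranclp.rtrancl_into_rtrancl)
  qed simp
  have "(adj T)\<^sup>*\<^sup>* u0 w" if w: "w \<in> verts W2" for w
  proof -
    obtain D where D: "block W2 D" "w \<in> verts D" using clique_tree_vertex_in_block[OF W2 w] .
    then have "adj T (g D) w" using nbr_g adj_T by blast
    with reach1[OF g_verts[OF D(1)]] show ?thesis by (rule rtranclp.rtrancl_into_rtrancl)
  qed
  with reach1 u0 show ?thesis
    by (intro connected_graphI[OF simple_T, of u0]) (auto simp: verts_T)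
qed

text \<open>A cycle through \<open>u\<close> in \<open>W1\<close> projects to a walk in \<open>W2\<close> which joins two vertices of the
  block \<open>D\<close> with \<open>g D = u\<close> and uses no edge of \<open>D\<close>.\<close>

lemma no_cycle_from_W1:
  assumes "cycle T (u # q)" "u \<in> verts W1"
  shows False
proof -
  have q: "length q \<ge> 2" "distinct q" "u \<notin> set q" "successively (adj T) q"
    "adj T u (hd q)" "adj T (last q) u"
    using assms(1) unfolding cycle_def by (auto simp: successively_Cons split: if_splits)
  let ?w = "hd q" and ?w' = "last q"
  have "q \<noteq> []" using q(1) by auto
  have w: "nbr u ?w" "nbr u ?w'"
    using q(5) adj_sym[OF q(6)] adj_T_side(1)[OF assms(2)] by blast+
  have ne: "?w \<noteq> ?w'" using q(1,2) by (cases q; cases "tl q") auto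
  obtain D where D: "block W2 D" "g D = u" "?w \<in> verts D" "?w' \<in> verts D"
    using nbr_two[OF w ne] .
  let ?R = "\<lambda>a b. adj W2 a b \<and> \<not> {a, b} \<subseteq> verts D"
  let ?Q = "\<lambda>a b. adj T a b \<and> a \<noteq> u \<and> b \<noteq> u"
  have "successively ?Q q"
    using q(4) by (rule successively_mono) (use q(3) in auto)
  from successively_rtranclp[OF this \<open>q \<noteq> []\<close>] have Q: "?Q\<^sup>*\<^sup>* ?w ?w'" .
  \<comment> \<open>The projected walk lives in \<open>W2\<close>, so at a vertex of
    \<open>W1\<close> the invariant records some neighbour that the walk has reached.\<close>
  have "(z \<in> verts W2 \<longrightarrow> ?R\<^sup>*\<^sup>* ?w z) \<and> (z \<in> verts W1 \<longrightarrow> (\<exists>z'. nbr z z' \<and> ?R\<^sup>*\<^sup>* ?w z'))"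
    if "?Q\<^sup>*\<^sup>* ?w z" for z
    using that
  proof (induction rule: rtranclp_induct)
    case base
    show ?case using nbr_verts(2)[OF w(1)] disjoint by blast
  next
    case (step z y)
    then consider "nbr z y" | "nbr y z" using adj_T by blast
    then show ?case
    proof cases
      case 1
      note v = nbr_verts[OF 1]
      then obtain z' where z': "nbr z z'" "?R\<^sup>*\<^sup>* ?w z'" using step.IH by blast
      have "?R\<^sup>*\<^sup>* ?w y"
      proof (cases "z' = y")
        case False
        obtain E where E: "block W2 E" "g E = z" "z' \<in> verts E" "y \<in> verts E"
          using nbr_two[OF z'(1) 1 False] .
        \<comment> \<open>\<open>E = D\<close> would give \<open>z = u\<close>, but the walk avoids
          \<open>u\<close>.\<close>
        have "\<not> {z', y} \<subseteq> verts D"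
          using clique_tree_blocks_share[OF W2 D(1) E(1) False] D E step.hyps(2) by blast
        then have "?R z' y" using clique_tree_blockD[OF W2 E(1,3,4) False] by blast
        with z'(2) show ?thesis by (rule rtranclp.rtrancl_into_rtrancl)
      qed (use z' in simp)
      then show ?thesis using v disjoint by blast
    next
      case 2
      then show ?thesis using nbr_verts[OF 2] step.IH disjoint by blast
    qed
  qed
  from this[OF Q] have "?R\<^sup>*\<^sup>* ?w ?w'" using nbr_verts(2)[OF w(2)] by blast
  with clique_tree_path_uses_block[OF W2 D(1,3,4) ne, of ?R] show False by blast
qed

lemma tree_T: "tree T"
proof -
  have False if c: "cycle T p" for p
  proof -
    obtain x y r where p: "p = x # y # r"
      using c unfolding cycle_def by (cases p; cases "tl p") auto
    have xy: "adj T x y" using c p by (auto simp: cycle_def)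
    show False
    proof (cases "x \<in> verts W1")
      case True
      then show ?thesis using no_cycle_from_W1 c p by blast
    next
      case False
      then have "y \<in> verts W1" using xy nbr_verts unfolding adj_T by blast
      \<comment> \<open>A cycle starting in \<open>W2\<close> is rotated by one vertex.\<close>
      moreover have "cycle T (y # r @ [x])"
        using c p unfolding cycle_def
        by (auto simp: successively_append_iff successively_Cons split: if_splits)
      ultimately show ?thesis using no_cycle_from_W1 by blast
    qed
  qed
  then show ?thesis using simple_T connected_T unfolding tree_def by blast
qed

end

section \<open>Passing between embeddings of \<open>What\<close> and maps on blocks\<close>

theorem theorem13:
  fixes W1 W2 G :: "'a ugraph" and What :: "('a + 'a ugraph) ugraph"
  assumes "clique_tree W1" and "clique_tree W2"
    and "verts W1 \<inter> verts W2 = {}"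
    and "G = graph_union W1 W2"
    and "connected_component (exact_dist_square (canonical_tree W1)) What"
    and "What \<noteq> graph_image Inl W1"
  shows "(\<exists>T :: 'a ugraph. tree T \<and> exact_dist_square T = G) \<longleftrightarrow>
         (\<exists>\<phi> K. induced_subgraph K W2 \<and> graph_iso \<phi> What K \<and>
            (\<forall>v\<in>verts What. degree (canonical_tree W1) v \<ge> card {B. block W2 B \<and> \<phi> v \<in> verts B}) \<and>
            (\<forall>w. cut_vertex W2 w \<longrightarrow> w \<in> \<phi> ` verts What))"
    (is "?L \<longleftrightarrow> ?R")
proof
  note simple2 = clique_tree_simple[OF assms(2)]
  note verts_What = canonical_tree_other_component(1)[OF assms(1,5,6)]
  note adj_What = canonical_tree_other_component(2)[OF assms(1,5,6)]
  {
    assume ?L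
    then obtain T where T: "tree T" "exact_dist_square T = G" by blast
    interpret square_root_tree T W1 W2 by unfold_locales (use assms T in simp_all)
    obtain f where f: "\<And>B. block W1 B \<Longrightarrow> f B \<in> verts W2"
      and inj: "inj_on f {B. block W1 B}"
      and f_adj: "\<And>B D. block W1 B \<Longrightarrow> block W1 D \<Longrightarrow>
        adj W2 (f B) (f D) \<longleftrightarrow> B \<noteq> D \<and> verts B \<inter> verts D \<noteq> {}"
      and f_card: "\<And>B. block W1 B \<Longrightarrow> card {D. block W2 D \<and> f B \<in> verts D} \<le> card (verts B)"
      and f_cut: "\<And>w. cut_vertex W2 w \<Longrightarrow> \<exists>B. block W1 B \<and> w = f B"
      using embedding_exists by blast
    let ?S = "f ` {B. block W1 B}"
    let ?K = "induced_on W2 ?S"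
    \<comment> \<open>\<open>What\<close> has no vertex of the form \<open>Inl u\<close>, so the
      value there is arbitrary.\<close>
    let ?\<phi> = "case_sum undefined f"
    have "induced_subgraph ?K W2"
      using subgraph_induced_on[OF simple2, of ?S] f
      by (auto simp: induced_subgraph_def) (auto simp: induced_on_def)
    moreover have "graph_iso ?\<phi> What ?K"
      unfolding graph_iso_def
    proof (intro conjI ballI)
      show "bij_betw ?\<phi> (verts What) (verts ?K)"
        using inj by (auto simp: bij_betw_def verts_What inj_on_def image_image)
      fix x y assume "x \<in> verts What" "y \<in> verts What"
      then obtain B D where "x = Inr B" "block W1 B" "y = Inr D" "block W1 D"
        unfolding verts_What by blast
      then show "adj What x y \<longleftrightarrow> adj ?K (?\<phi> x) (?\<phi> y)" using f_adj by (simp add: adj_What)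
    qed
    moreover have "\<forall>v\<in>verts What. degree (canonical_tree W1) v \<ge> card {B. block W2 B \<and> ?\<phi> v \<in> verts B}"
      using f_card by (auto simp: verts_What degree_canonical_tree_Inr)
    moreover have "\<forall>w. cut_vertex W2 w \<longrightarrow> w \<in> ?\<phi> ` verts What"
      using f_cut by (force simp: verts_What)
    ultimately show ?R by blast
  }
  assume ?R
  then obtain \<phi> K where K: "induced_subgraph K W2" and iso: "graph_iso \<phi> What K"
    and deg: "\<And>v. v \<in> verts What \<Longrightarrow> card {B. block W2 B \<and> \<phi> v \<in> verts B} \<le> degree (canonical_tree W1) v"
    and cut: "\<And>w. cut_vertex W2 w \<Longrightarrow> w \<in> \<phi> ` verts What" by blast
  let ?f = "\<lambda>B. \<phi> (Inr B)"
  have bij: "bij_betw \<phi> (verts What) (verts K)"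
    and adj_iso: "\<And>x y. x \<in> verts What \<Longrightarrow> y \<in> verts What \<Longrightarrow> adj What x y \<longleftrightarrow> adj K (\<phi> x) (\<phi> y)"
    using iso by (auto simp: graph_iso_def)
  \<comment> \<open>Inducedness enters here: edges of \<open>W2\<close> between image vertices are
    edges of \<open>K\<close>.\<close>
  have adj_K: "adj K x y \<longleftrightarrow> adj W2 x y" if "x \<in> verts K" "y \<in> verts K" for x y
    using K that by (auto simp: induced_subgraph_def subgraph_def adj_def)
  have fK: "?f B \<in> verts K" if "block W1 B" for B
    using bij that by (auto simp: bij_betw_def verts_What)
  interpret E: block_embedding W1 W2 ?f
  proof
    show "?f B \<in> verts W2" if "block W1 B" for B
      using fK[OF that] K by (auto simp: induced_subgraph_def subgraph_def)
    show "B = D" if "block W1 B" "block W1 D" "?f B = ?f D" for B D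
      using bij that by (auto simp: bij_betw_def verts_What inj_on_def)
    show "adj W2 (?f B) (?f D) \<longleftrightarrow> B \<noteq> D \<and> verts B \<inter> verts D \<noteq> {}"
      if "block W1 B" "block W1 D" for B D
      using adj_iso[of "Inr B" "Inr D"] adj_K[OF fK fK] that by (simp add: verts_What adj_What)
    show "card {D. block W2 D \<and> ?f B \<in> verts D} \<le> card (verts B)" if "block W1 B" for B
      using deg[of "Inr B"] that by (simp add: verts_What degree_canonical_tree_Inr)
    show "\<exists>B. block W1 B \<and> w = ?f B" if "cut_vertex W2 w" for w
      using cut[OF that] by (auto simp: verts_What)
  qed (use assms in simp_all)
  obtain g where g: "inj_on g {D. block W2 D}"
    "\<And>B D. block W1 B \<Longrightarrow> block W2 D \<Longrightarrow> ?f B \<in> verts D \<Longrightarrow> g D \<in> verts B"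
    using E.assignment_exists by blast
  interpret A: block_assignment W1 W2 ?f g
    by unfold_locales (use g assms in \<open>auto simp: inj_on_def\<close>)
  show ?L using A.tree_T A.square_T assms(4) by blast
qed

end
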